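(* Suppose that $\Omega\subset\mathbb{R}^2$ is a non-concentric annulus. Then the fail point in $\overline\Omega$ is always located at the point on the inner ring (inner boundary circle) closest to the center of the outer ring (outer boundary circle).
   Context: A non-concentric annulus is a domain of the form $\Omega=\{x\in\mathbb{R}^2: |x-O|<\rho_1,\ |x-I|>\rho_2\}$ with $O\neq I$, $\rho_1,\rho_2>0$ and $|O-I|+\rho_2<\rho_1$; its outer ring is the circle $\{|x-O|=\rho_1\}$ and its inner ring is $\{|x-I|=\rho_2\}$. The torsion function of $\Omega$ is the unique solution $u$ of $-\Delta u=1$ in $\Omega$, $u=0$ on $\partial\Omega$ (on the whole boundary). A fail point is a point of $\overline\Omega$ at which $|\nabla u|$ attains its maximum over $\overline\Omega$. *)

theory Defs
  imports "HOL-Analysis.Analysis"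
begin

definition annulus :: "real^2 \<Rightarrow> real \<Rightarrow> real^2 \<Rightarrow> real \<Rightarrow> (real^2) set" where
  "annulus cO \<rho>\<^sub>1 cI \<rho>\<^sub>2 = {x. norm (x - cO) < \<rho>\<^sub>1 \<and> norm (x - cI) > \<rho>\<^sub>2}"

definition nonconcentric_annulus :: "real^2 \<Rightarrow> real \<Rightarrow> real^2 \<Rightarrow> real \<Rightarrow> bool" where
  "nonconcentric_annulus cO \<rho>\<^sub>1 cI \<rho>\<^sub>2 \<longleftrightarrow>
     cO \<noteq> cI \<and> \<rho>\<^sub>1 > 0 \<and> \<rho>\<^sub>2 > 0 \<and> norm (cO - cI) + \<rho>\<^sub>2 < \<rho>\<^sub>1"

definition inner_ring :: "real^2 \<Rightarrow> real \<Rightarrow> (real^2) set" where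
  "inner_ring cI \<rho>\<^sub>2 = {x. norm (x - cI) = \<rho>\<^sub>2}"

definition partial :: "'a::euclidean_space \<Rightarrow> ('a \<Rightarrow> real) \<Rightarrow> 'a \<Rightarrow> real" where
  "partial b u x = deriv (\<lambda>t. u (x + t *\<^sub>R b)) 0"

(* Meant for open S. Differentiability of u and of its first partial derivatives
   guarantees that every value of deriv involved is a genuine derivative. *)
definition C2_on :: "('a::euclidean_space \<Rightarrow> real) \<Rightarrow> 'a set \<Rightarrow> bool" where
  "C2_on u S \<longleftrightarrow> u differentiable_on S \<and>
     (\<forall>b\<in>Basis. partial b u differentiable_on S \<and>
        (\<forall>c\<in>Basis. continuous_on S (partial c (partial b u))))"

definition laplacian :: "('a::euclidean_space \<Rightarrow> real) \<Rightarrow> 'a \<Rightarrow> real" where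
  "laplacian u x = (\<Sum>b\<in>Basis. partial b (partial b u) x)"

(* Classical solution. The function u is total; its values outside the closure of S
   are arbitrary and irrelevant. *)
definition torsion_function :: "(real^2) set \<Rightarrow> (real^2 \<Rightarrow> real) \<Rightarrow> bool" where
  "torsion_function S u \<longleftrightarrow>
     C2_on u S \<and> continuous_on (closure S) u \<and>
     (\<forall>x\<in>S. - laplacian u x = 1) \<and> (\<forall>x\<in>frontier S. u x = 0)"

(* The derivative is taken within T, so that with T the closure of a smooth domain the
   gradient is also defined (one-sidedly, and uniquely) at boundary points. *)
definition gradient_within :: "('a::euclidean_space \<Rightarrow> real) \<Rightarrow> 'a set \<Rightarrow> 'a \<Rightarrow> 'a" where
  "gradient_within u T x = (THE g. (u has_derivative (\<lambda>h. inner h g)) (at x within T))"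

(* Differentiability up to the boundary is part of being a fail point, so that the
   gradients that are compared are never junk values. *)
definition fail_point :: "(real^2) set \<Rightarrow> (real^2 \<Rightarrow> real) \<Rightarrow> real^2 \<Rightarrow> bool" where
  "fail_point S u x \<longleftrightarrow>
     u differentiable_on closure S \<and> x \<in> closure S \<and>
     (\<forall>y\<in>closure S. norm (gradient_within u (closure S) y)
                        \<le> norm (gradient_within u (closure S) x))"

end

theory Submission
  imports Defs "HOL-Complex_Analysis.Complex_Analysis"
begin

text \<open>Normalise the annulus so that the outer ring is the unit circle and the inner ring has centre
  \<open>a > 0\<close> and radius \<open>s\<close>. Mapping it conformally onto a concentric annulus gives the torsion function
  as an explicit series that converges beyond the closed annulus, so by uniqueness the torsion
  function is smooth up to the boundary. Its gradient \<open>g\<close> has no interior maximum of \<open>|g|\<close>, since every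
  directional derivative is harmonic. On the boundary \<open>|g|\<close> is the inward normal derivative. Whenever a
  line cuts off a cap of the annulus whose reflection stays in the annulus, the maximum principle
  gives \<open>v \<le> v \<circ> reflection\<close> on the cap and Hopf's lemma makes the comparison of normal derivatives
  strict. Reflections in lines through the centre of the inner ring show that \<open>a - s\<close> is the only maximum on the
  inner ring, those in lines through the centre of the outer ring that \<open>-1\<close> is a maximum on the outer
  ring, and the reflection exchanging \<open>-1\<close> and \<open>a - s\<close> compares the two.\<close>

section \<open>Functions with a Laplacian\<close>

text \<open>The obstacle is the boundary: \<open>fail_point\<close> compares gradients taken within
  the closed annulus, whereas a classical solution is only continuous there. The explicit formula
  that supplies the missing regularity exists because \<open>(cmod z)\<^sup>2\<close> is affine in
  \<open>Re z\<close> on the inner ring. In the conformal coordinate the data on that ring become a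
  rational function whose only pole \<open>- 1 / \<beta>\<close> lies outside the ring, so the
  coefficients decay geometrically.

  Strict comparison is used on the inner ring and between the rings; along the outer ring the weak
  one suffices. Hopf's lemma asks for a ball touching the boundary at a point off the mirror line,
  and for positivity of the difference inside that ball. A cap bent around the inner disc need not
  be convex, so positivity is spread through a convex piece of it, starting from a point of the
  outer ring whose mirror image is interior.\<close>

lemma has_derivative_along_line:
  fixes f :: "'a::real_inner \<Rightarrow> real"
  assumes "(f has_derivative (\<lambda>h. g \<bullet> h)) (at q)"
  shows "((\<lambda>t. f (q + t *\<^sub>R h)) has_real_derivative g \<bullet> h) (at 0)"
proof -
  have "((\<lambda>t. q + t *\<^sub>R h) has_derivative (\<lambda>t. t *\<^sub>R h)) (at 0)"
    by (auto intro!: derivative_eq_intros)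
  from has_derivative_compose[OF this, of f "\<lambda>h. g \<bullet> h"] assms
  have "((\<lambda>t. f (q + t *\<^sub>R h)) has_derivative (\<lambda>t. t * (g \<bullet> h))) (at 0)"
    by simp
  then show ?thesis unfolding has_field_derivative_def mult_commute_abs .
qed

text \<open>A gradient field and the trace of its derivative replace iterated partial derivatives.
  In this form sums, affine changes of variable and gradients given by complex functions can be
  treated directly.\<close>

definition has_laplacian :: "('a::euclidean_space \<Rightarrow> real) \<Rightarrow> ('a \<Rightarrow> real) \<Rightarrow> 'a set \<Rightarrow> bool" where
  "has_laplacian u f S \<longleftrightarrow>
     (\<exists>g H. \<forall>x\<in>S. (u has_derivative (\<lambda>h. g x \<bullet> h)) (at x) \<and> (g has_derivative H x) (at x) \<and>
        (\<Sum>b\<in>Basis. H x b \<bullet> b) = f x)"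

lemma has_laplacianI:
  assumes "\<And>x. x \<in> S \<Longrightarrow> (u has_derivative (\<lambda>h. g x \<bullet> h)) (at x)"
    and "\<And>x. x \<in> S \<Longrightarrow> (g has_derivative H x) (at x)"
    and "\<And>x. x \<in> S \<Longrightarrow> (\<Sum>b\<in>Basis. H x b \<bullet> b) = f x"
  shows "has_laplacian u f S"
  unfolding has_laplacian_def using assms by blast

lemma has_laplacianE:
  assumes "has_laplacian u f S"
  obtains g H where "\<And>x. x \<in> S \<Longrightarrow> (u has_derivative (\<lambda>h. g x \<bullet> h)) (at x)"
    and "\<And>x. x \<in> S \<Longrightarrow> (g has_derivative H x) (at x)"
    and "\<And>x. x \<in> S \<Longrightarrow> (\<Sum>b\<in>Basis. H x b \<bullet> b) = f x"
  using assms unfolding has_laplacian_def by blast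

lemma has_laplacian_subset:
  assumes "has_laplacian u f S" "T \<subseteq> S"
  shows "has_laplacian u f T"
  by (rule has_laplacianE[OF assms(1)], rule has_laplacianI) (use assms(2) in auto)

lemma has_laplacian_cong:
  assumes "has_laplacian u f S" "\<And>x. x \<in> S \<Longrightarrow> f x = f' x"
  shows "has_laplacian u f' S"
  by (rule has_laplacianE[OF assms(1)], rule has_laplacianI) (use assms(2) in auto)

lemma has_laplacian_continuous_on:
  assumes "has_laplacian u f S"
  shows "continuous_on S u"
proof -
  obtain g where "\<And>x. x \<in> S \<Longrightarrow> (u has_derivative (\<lambda>h. g x \<bullet> h)) (at x)"
    using assms by (rule has_laplacianE) (rule that)
  then show ?thesis
    by (intro continuous_at_imp_continuous_on ballI) (rule has_derivative_continuous)
qed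

lemma has_laplacian_lincomb:
  assumes "has_laplacian u f S" "has_laplacian v f' S"
  shows "has_laplacian (\<lambda>x. k * u x + l * v x) (\<lambda>x. k * f x + l * f' x) S"
proof -
  obtain g H where 1: "\<And>x. x\<in>S \<Longrightarrow> (u has_derivative (\<lambda>h. g x \<bullet> h)) (at x)"
    "\<And>x. x\<in>S \<Longrightarrow> (g has_derivative H x) (at x)" "\<And>x. x\<in>S \<Longrightarrow> (\<Sum>b\<in>Basis. H x b \<bullet> b) = f x"
    using assms(1) by (rule has_laplacianE) (rule that)
  obtain g' H' where 2: "\<And>x. x\<in>S \<Longrightarrow> (v has_derivative (\<lambda>h. g' x \<bullet> h)) (at x)"
    "\<And>x. x\<in>S \<Longrightarrow> (g' has_derivative H' x) (at x)" "\<And>x. x\<in>S \<Longrightarrow> (\<Sum>b\<in>Basis. H' x b \<bullet> b) = f' x"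
    using assms(2) by (rule has_laplacianE) (rule that)
  show ?thesis
  proof (rule has_laplacianI[where g="\<lambda>x. k *\<^sub>R g x + l *\<^sub>R g' x" and H="\<lambda>x h. k *\<^sub>R H x h + l *\<^sub>R H' x h"])
    fix x assume x: "x \<in> S"
    show "((\<lambda>x. k * u x + l * v x) has_derivative (\<lambda>h. (k *\<^sub>R g x + l *\<^sub>R g' x) \<bullet> h)) (at x)"
      unfolding inner_add_left inner_scaleR_left by (intro derivative_intros 1 2 x)
    show "((\<lambda>x. k *\<^sub>R g x + l *\<^sub>R g' x) has_derivative (\<lambda>h. k *\<^sub>R H x h + l *\<^sub>R H' x h)) (at x)"
      by (intro derivative_intros 1 2 x)
    show "(\<Sum>b\<in>Basis. (k *\<^sub>R H x b + l *\<^sub>R H' x b) \<bullet> b) = k * f x + l * f' x"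
      by (simp add: inner_add_left sum.distrib sum_distrib_left[symmetric] 1 2 x)
  qed
qed

lemma has_laplacian_diff:
  assumes "has_laplacian u f S" "has_laplacian v f' S"
  shows "has_laplacian (\<lambda>x. u x - v x) (\<lambda>x. f x - f' x) S"
  using has_laplacian_lincomb[OF assms, of 1 "-1"] by simp

lemma has_laplacian_norm_sq:
  "has_laplacian (\<lambda>x::'a::euclidean_space. (norm (x - c))\<^sup>2) (\<lambda>_. 2 * DIM('a)) S"
proof (rule has_laplacianI[where g="\<lambda>x. 2 *\<^sub>R (x - c)" and H="\<lambda>x h. 2 *\<^sub>R h"])
  fix x :: 'a
  show "((\<lambda>x. (norm (x - c))\<^sup>2) has_derivative (\<lambda>h. (2 *\<^sub>R (x - c)) \<bullet> h)) (at x)"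
    unfolding power2_norm_eq_inner
    by (auto intro!: derivative_eq_intros simp: inner_commute)
  show "((\<lambda>x. 2 *\<^sub>R (x - c)) has_derivative (\<lambda>h. 2 *\<^sub>R h)) (at x)"
    by (auto intro!: derivative_eq_intros)
qed simp

text \<open>The Hessian of the composition is \<open>T'\<close> H \<open>T\<close>; its trace equals
  that of H \<open>T\<close> \<open>T'\<close>, hence \<kappa> times the trace of H. The factor is 1
  for a reflection and \<open>\<rho>\<^sub>1\<^sup>2\<close> for the similarity onto the given
  annulus. That similarity joins two different types, so the adjoint appears as a separate
  map.\<close>

lemma has_laplacian_compose_conformal:
  fixes T :: "'a::euclidean_space \<Rightarrow> 'b::euclidean_space"
  assumes u: "has_laplacian u f S" and T: "bounded_linear T" and T': "bounded_linear T'"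
    and adj: "\<And>h k. T h \<bullet> k = h \<bullet> T' k" and conf: "\<And>k. T (T' k) = \<kappa> *\<^sub>R k"
  shows "has_laplacian (\<lambda>x. u (c + T x)) (\<lambda>x. \<kappa> * f (c + T x)) {x. c + T x \<in> S}"
proof -
  obtain g H where 1: "\<And>x. x\<in>S \<Longrightarrow> (u has_derivative (\<lambda>h. g x \<bullet> h)) (at x)"
    "\<And>x. x\<in>S \<Longrightarrow> (g has_derivative H x) (at x)" "\<And>x. x\<in>S \<Longrightarrow> (\<Sum>b\<in>Basis. H x b \<bullet> b) = f x"
    using assms(1) by (rule has_laplacianE) (rule that)
  show ?thesis
  proof (rule has_laplacianI[where g="\<lambda>x. T' (g (c + T x))" and H="\<lambda>x h. T' (H (c + T x) (T h))"])
    fix x assume "x \<in> {x. c + T x \<in> S}"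
    then have x: "c + T x \<in> S" by simp
    have d: "((\<lambda>x. c + T x) has_derivative T) (at x)"
      using bounded_linear_imp_has_derivative[OF T] by (auto intro!: derivative_eq_intros)
    show "((\<lambda>x. u (c + T x)) has_derivative (\<lambda>h. T' (g (c + T x)) \<bullet> h)) (at x)"
      using has_derivative_compose[OF d 1(1)[OF x]] by (simp add: inner_commute flip: adj)
    show "((\<lambda>x. T' (g (c + T x))) has_derivative (\<lambda>h. T' (H (c + T x) (T h)))) (at x)"
      by (rule bounded_linear.has_derivative[OF T' has_derivative_compose[OF d 1(2)[OF x]]])
    let ?L = "H (c + T x)"
    have L: "linear ?L" using 1(2)[OF x] has_derivative_linear by blast
    \<comment> \<open>The entry at \<open>d\<close>, \<open>d'\<close> of the matrix of
      \<open>T\<close> after \<open>T'\<close>. Together with the expansion below it carries out the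
      cyclic invariance of the trace in coordinates.\<close>
    have key: "(\<Sum>b\<in>Basis. (T b \<bullet> d) * (T b \<bullet> d')) = \<kappa> * (d \<bullet> d')" for d d'
    proof -
      have "(\<Sum>b\<in>Basis. (T b \<bullet> d) * (T b \<bullet> d')) = T' d \<bullet> T' d'"
        unfolding adj by (subst (3) euclidean_inner) (simp add: inner_commute mult.commute)
      also have "\<dots> = T (T' d) \<bullet> d'" by (simp add: adj)
      finally show ?thesis by (simp add: conf)
    qed
    have ex: "?L (T b) \<bullet> T b = (\<Sum>d\<in>Basis. \<Sum>d'\<in>Basis. (?L d \<bullet> d') * ((T b \<bullet> d) * (T b \<bullet> d')))" for b
    proof -
      have "?L (T b) = ?L (\<Sum>d\<in>Basis. (T b \<bullet> d) *\<^sub>R d)" by (simp add: euclidean_representation)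
      also have "\<dots> = (\<Sum>d\<in>Basis. (T b \<bullet> d) *\<^sub>R ?L d)" by (simp add: linear_sum[OF L] linear_cmul[OF L])
      finally have "?L (T b) \<bullet> T b = (\<Sum>d\<in>Basis. (T b \<bullet> d) * (?L d \<bullet> T b))"
        by (simp add: inner_sum_left)
      also have "\<dots> = (\<Sum>d\<in>Basis. (T b \<bullet> d) * (\<Sum>d'\<in>Basis. (?L d \<bullet> d') * (T b \<bullet> d')))"
        by (subst euclidean_inner) simp
      finally show ?thesis by (simp add: sum_distrib_left mult_ac)
    qed
    have "(\<Sum>b\<in>Basis. ?L (T b) \<bullet> T b) =
       (\<Sum>d\<in>Basis. \<Sum>d'\<in>Basis. (?L d \<bullet> d') * (\<Sum>b\<in>Basis. (T b \<bullet> d) * (T b \<bullet> d')))"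
      unfolding ex sum_distrib_left
      by (subst sum.swap, rule sum.cong[OF refl], subst sum.swap, rule refl)
    also have "\<dots> = (\<Sum>d\<in>Basis. \<Sum>d'\<in>Basis. (?L d \<bullet> d') * (\<kappa> * (if d = d' then 1 else 0)))"
      by (intro sum.cong refl) (simp add: key inner_Basis)
    also have "\<dots> = (\<Sum>d\<in>Basis. \<Sum>d'\<in>Basis. if d = d' then \<kappa> * (?L d \<bullet> d) else 0)"
      by (intro sum.cong refl) auto
    also have "\<dots> = \<kappa> * f (c + T x)"
      using 1(3)[OF x] by (simp flip: sum_distrib_left)
    finally show "(\<Sum>b\<in>Basis. T' (?L (T b)) \<bullet> b) = \<kappa> * f (c + T x)"
      by (simp add: inner_commute flip: adj)
  qed
qed

lemma has_laplacian_C2_on: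
  assumes S: "open S" and u: "C2_on u S"
  shows "has_laplacian u (laplacian u) S"
proof -
  have pd: "partial b f x = D b" if "(f has_derivative D) (at x)" for f :: "'a \<Rightarrow> real" and b x D
  proof -
    have "((\<lambda>t. x + t *\<^sub>R b) has_derivative (\<lambda>t. t *\<^sub>R b)) (at 0)"
      by (auto intro!: derivative_eq_intros)
    then have "((\<lambda>t. f (x + t *\<^sub>R b)) has_derivative (\<lambda>t. D (t *\<^sub>R b))) (at 0)"
      using has_derivative_compose[of "\<lambda>t. x + t *\<^sub>R b" _ 0 UNIV f D] that by simp
    then have "((\<lambda>t. f (x + t *\<^sub>R b)) has_field_derivative D b) (at 0)"
      unfolding has_field_derivative_def
      using linear_cmul[OF has_derivative_linear[OF that]] by (simp add: mult_commute_abs)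
    then show ?thesis unfolding partial_def by (rule DERIV_imp_deriv)
  qed
  have du: "(u has_derivative frechet_derivative u (at x)) (at x)" if "x \<in> S" for x
    using u S that unfolding C2_on_def
    by (metis at_within_open differentiable_on_def frechet_derivative_works)
  have dp: "(partial b u has_derivative frechet_derivative (partial b u) (at x)) (at x)"
    if "x \<in> S" "b \<in> Basis" for x b
    using u S that unfolding C2_on_def
    by (metis at_within_open differentiable_on_def frechet_derivative_works)
  show ?thesis
  proof (rule has_laplacianI[where g="\<lambda>x. \<Sum>b\<in>Basis. partial b u x *\<^sub>R b"
        and H="\<lambda>x h. \<Sum>b\<in>Basis. frechet_derivative (partial b u) (at x) h *\<^sub>R b"])
    fix x assume x: "x \<in> S"
    let ?D = "frechet_derivative u (at x)"
    have lin: "linear ?D" using du[OF x] has_derivative_linear by blast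
    have "?D h = (\<Sum>b\<in>Basis. partial b u x *\<^sub>R b) \<bullet> h" for h
    proof -
      have "?D h = ?D (\<Sum>b\<in>Basis. (h \<bullet> b) *\<^sub>R b)" by (simp add: euclidean_representation)
      also have "\<dots> = (\<Sum>b\<in>Basis. (h \<bullet> b) * ?D b)" by (simp add: linear_sum[OF lin] linear_cmul[OF lin])
      finally show ?thesis
        unfolding inner_sum_left inner_scaleR_left pd[OF du[OF x]] by (simp add: inner_commute mult.commute)
    qed
    then have "?D = (\<lambda>h. (\<Sum>b\<in>Basis. partial b u x *\<^sub>R b) \<bullet> h)" by blast
    then show "(u has_derivative (\<lambda>h. (\<Sum>b\<in>Basis. partial b u x *\<^sub>R b) \<bullet> h)) (at x)"
      using du[OF x] by metis
    show "((\<lambda>x. \<Sum>b\<in>Basis. partial b u x *\<^sub>R b) has_derivative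
        (\<lambda>h. \<Sum>b\<in>Basis. frechet_derivative (partial b u) (at x) h *\<^sub>R b)) (at x)"
      by (intro derivative_intros dp x)
    have "(\<Sum>c\<in>Basis. frechet_derivative (partial c u) (at x) b *\<^sub>R c) \<bullet> b = partial b (partial b u) x"
      if b: "b \<in> Basis" for b
      using b by (simp add: inner_sum_left_Basis pd[OF dp[OF x b]])
    then show "(\<Sum>b\<in>Basis. (\<Sum>c\<in>Basis. frechet_derivative (partial c u) (at x) b *\<^sub>R c) \<bullet> b) = laplacian u x"
      unfolding laplacian_def by (rule sum.cong[OF refl])
  qed
qed

section \<open>Second derivative test and weak minimum principle\<close>

lemma has_laplacian_local_min:
  assumes u: "has_laplacian u f S" and S: "open S" "x \<in> S" and min: "\<And>y. y \<in> S \<Longrightarrow> u x \<le> u y"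
  shows "f x \<ge> 0"
proof -
  obtain g H where 1: "\<And>x. x\<in>S \<Longrightarrow> (u has_derivative (\<lambda>h. g x \<bullet> h)) (at x)"
    "\<And>x. x\<in>S \<Longrightarrow> (g has_derivative H x) (at x)" "\<And>x. x\<in>S \<Longrightarrow> (\<Sum>b\<in>Basis. H x b \<bullet> b) = f x"
    using assms(1) by (rule has_laplacianE) (rule that)
  have "H x b \<bullet> b \<ge> 0" if b: "b \<in> Basis" for b
  proof (rule ccontr)
    assume neg: "\<not> ?thesis"
    obtain e where e: "e > 0" "ball x e \<subseteq> S" using S open_contains_ball by blast
    have inS: "x + t *\<^sub>R b \<in> S" if "\<bar>t\<bar> < e" for t
      using that e b by (auto simp: dist_norm intro!: subsetD[OF e(2)])
    define \<phi> where "\<phi> t = u (x + t *\<^sub>R b)" for t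
    define \<phi>' where "\<phi>' t = g (x + t *\<^sub>R b) \<bullet> b" for t
    have lin: "((\<lambda>t. x + t *\<^sub>R b) has_derivative (\<lambda>t. t *\<^sub>R b)) (at t)" for t
      by (auto intro!: derivative_eq_intros)
    have d1: "(\<phi> has_real_derivative \<phi>' t) (at t)" if "\<bar>t\<bar> < e" for t
      using has_derivative_compose[OF lin[of t], of u "\<lambda>h. g (x + t *\<^sub>R b) \<bullet> h"] 1(1)[OF inS[OF that]]
      unfolding has_field_derivative_def \<phi>_def \<phi>'_def by (simp add: mult_commute_abs)
    have "((\<lambda>t. g (x + t *\<^sub>R b)) has_derivative (\<lambda>t. H x (t *\<^sub>R b))) (at 0)"
      using has_derivative_compose[OF lin[of 0], of g "H x"] 1(2)[OF S(2)] by simp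
    then have "((\<lambda>t. g (x + t *\<^sub>R b) \<bullet> b) has_derivative (\<lambda>t. H x (t *\<^sub>R b) \<bullet> b)) (at 0)"
      by (rule has_derivative_inner_left)
    then have d2: "(\<phi>' has_real_derivative H x b \<bullet> b) (at 0)"
      unfolding has_field_derivative_def \<phi>'_def
      using linear_cmul[OF has_derivative_linear[OF 1(2)[OF S(2)]]] by (simp add: mult_commute_abs)
    have z: "\<phi>' 0 = 0"
      using d1[of 0] e(1) min[OF inS] by (intro DERIV_local_min[of \<phi> "\<phi>' 0" 0 e]) (auto simp: \<phi>_def)
    \<comment> \<open>A negative slope of \<open>\<phi>'\<close> at its zero makes
      \<open>\<phi>'\<close> negative just to the right, and the mean value theorem then produces a
      value below the minimum.\<close>
    obtain d where d: "d > 0" "\<And>h. 0 < h \<Longrightarrow> h < d \<Longrightarrow> \<phi>' h < \<phi>' 0"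
      using DERIV_neg_dec_right[OF d2] neg by auto
    define t where "t = min d e / 2"
    have t: "0 < t" "t < d" "t < e" using d e by (auto simp: t_def min_def)
    obtain \<xi> where \<xi>: "0 < \<xi>" "\<xi> < t" "\<phi> t - \<phi> 0 = (t - 0) * \<phi>' \<xi>"
      using MVT2[of 0 t \<phi> \<phi>'] d1 t by auto
    have "\<phi> t < \<phi> 0" using \<xi> d(2)[of \<xi>] z t by (smt (verit) mult_pos_neg)
    then show False using min[OF inS[of t]] t by (simp add: \<phi>_def)
  qed
  then have "(\<Sum>b\<in>Basis. H x b \<bullet> b) \<ge> 0" by (rule sum_nonneg)
  then show ?thesis using 1(3)[OF S(2)] by simp
qed

text \<open>Subtracting a small multiple of a squared distance makes the Laplacian strictly
  negative, which excludes a minimum in \<open>D\<close>. The set \<open>K - D\<close> plays the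
  role of the boundary.\<close>

lemma superharmonic_nonneg:
  fixes w :: "'a::euclidean_space \<Rightarrow> real"
  assumes K: "compact K" "continuous_on K w" and D: "open D" "D \<subseteq> K"
    and w: "has_laplacian w f D" "\<And>x. x \<in> D \<Longrightarrow> f x \<le> 0"
    and bd: "\<And>x. x \<in> K - D \<Longrightarrow> w x \<ge> 0" and x: "x \<in> K"
  shows "w x \<ge> 0"
proof (rule ccontr)
  assume neg: "\<not> ?thesis"
  obtain B where B: "B > 0" "\<And>y. y \<in> K \<Longrightarrow> norm (y - x) \<le> B"
  proof -
    have "compact ((\<lambda>y. y - x) ` K)" by (intro compact_continuous_image continuous_intros K)
    then obtain B where "B > 0" "\<forall>z\<in>(\<lambda>y. y - x) ` K. norm z \<le> B"
      using compact_imp_bounded bounded_pos by metis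
    then show thesis using that by auto
  qed
  \<comment> \<open>Small enough that the subtracted term is at most half the depth
    \<open>- w x\<close> on all of \<open>K\<close>. The minimiser of \<psi> therefore still has a
    negative value of \<open>w\<close> and must lie in \<open>D\<close>.\<close>
  define \<epsilon> where "\<epsilon> = - w x / (2 * B\<^sup>2)"
  have \<epsilon>: "\<epsilon> > 0" using neg B by (simp add: \<epsilon>_def field_simps)
  define \<psi> where "\<psi> y = 1 * w y + (- \<epsilon>) * (norm (y - x))\<^sup>2" for y
  have "continuous_on K \<psi>" unfolding \<psi>_def by (intro continuous_intros K)
  then obtain y where y: "y \<in> K" "\<And>z. z \<in> K \<Longrightarrow> \<psi> y \<le> \<psi> z"
    using continuous_attains_inf[OF K(1)] x by blast
  have yx: "\<psi> y \<le> w x" using y(2)[OF x] by (simp add: \<psi>_def)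
  have "(norm (y - x))\<^sup>2 \<le> B\<^sup>2" using B(2)[OF y(1)] by (simp add: power_mono)
  then have "\<epsilon> * (norm (y - x))\<^sup>2 \<le> \<epsilon> * B\<^sup>2" using \<epsilon> by simp
  also have "\<dots> = - w x / 2" using B by (simp add: \<epsilon>_def)
  finally have "w y < 0" using yx neg by (simp add: \<psi>_def)
  then have yD: "y \<in> D" using bd y(1) by (meson DiffI linorder_not_le)
  have "has_laplacian \<psi> (\<lambda>x. 1 * f x + (-\<epsilon>) * (2 * DIM('a))) D"
    unfolding \<psi>_def by (rule has_laplacian_lincomb[OF w(1) has_laplacian_norm_sq])
  from has_laplacian_local_min[OF this D(1) yD] y(2) D(2)
  have "f y - \<epsilon> * (2 * DIM('a)) \<ge> 0" by auto
  moreover have "\<epsilon> * (2 * DIM('a)) > 0" using \<epsilon> by simp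
  ultimately show False using w(2)[OF yD] by linarith
qed

section \<open>Hopf's lemma and the strong maximum principle\<close>

text \<open>By the Cauchy-Riemann equations a conjugated holomorphic field is divergence free, while
  \<open>of_real k * z\<close> has divergence \<open>2 * k\<close>. The torsion function uses
  \<open>k = - 1 / 2\<close>, harmonic functions use \<open>k = 0\<close>.\<close>

lemma has_laplacian_complex:
  fixes v :: "complex \<Rightarrow> real"
  assumes S: "open S" and G: "G holomorphic_on S"
    and v: "\<And>z. z \<in> S \<Longrightarrow> (v has_derivative (\<lambda>h. (cnj (G z) + of_real k * z) \<bullet> h)) (at z)"
  shows "has_laplacian v (\<lambda>_. 2 * k) S"
proof (rule has_laplacianI[where g="\<lambda>z. cnj (G z) + of_real k * z" and H="\<lambda>z h. cnj (deriv G z * h) + of_real k * h"])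
  fix z assume z: "z \<in> S"
  have "(G has_field_derivative deriv G z) (at z)"
    using G S z holomorphic_derivI by blast
  then have "(G has_derivative (\<lambda>h. deriv G z * h)) (at z)"
    by (simp add: has_field_derivative_def)
  then show "((\<lambda>z. cnj (G z) + of_real k * z) has_derivative (\<lambda>h. cnj (deriv G z * h) + of_real k * h)) (at z)"
    by (intro derivative_intros has_derivative_cnj)
  show "(\<Sum>b\<in>Basis. (cnj (deriv G z * b) + of_real k * b) \<bullet> b) = 2 * k"
    by (simp add: Basis_complex_def inner_complex_def)
qed (rule v)

text \<open>Locally this is the real part of a logarithm of \<open>F\<close>, so its gradient is the
  conjugated logarithmic derivative. The computation through the norm avoids choosing a
  branch.\<close>

lemma has_derivative_ln_cmod:
  assumes F: "(F has_field_derivative F') (at z)" and nz: "F z \<noteq> 0"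
  shows "((\<lambda>z. ln (cmod (F z))) has_derivative (\<lambda>h. cnj (F' / F z) \<bullet> h)) (at z)"
proof -
  have n: "((\<lambda>z. cmod (F z)) has_derivative (\<lambda>h. sgn (F z) \<bullet> (F' * h))) (at z)"
    using has_derivative_compose[OF F[unfolded has_field_derivative_def] has_derivative_norm[OF nz]]
    by (simp add: inner_commute)
  have "((\<lambda>z. ln (cmod (F z))) has_derivative (\<lambda>h. (sgn (F z) \<bullet> (F' * h)) * inverse (cmod (F z)))) (at z)"
    using has_derivative_ln[OF _ n] nz by simp
  moreover have "(sgn (F z) \<bullet> (F' * h)) * inverse (cmod (F z)) = cnj (F' / F z) \<bullet> h" for h
  proof -
    have "(sgn (F z) \<bullet> (F' * h)) * inverse (cmod (F z)) = (F z \<bullet> (F' * h)) / (cmod (F z))\<^sup>2"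
      by (simp add: sgn_div_norm power2_eq_square field_simps)
    also have "\<dots> = Re (cnj (F z) * F' * h / (cmod (F z))\<^sup>2)"
      by (simp add: inner_complex_def algebra_simps flip: of_real_power)
    also have "cnj (F z) * F' * h / (cmod (F z))\<^sup>2 = F' / F z * h"
      using nz by (simp add: complex_norm_square[of "F z"] field_simps del: of_real_power)
    also have "Re \<dots> = cnj (F' / F z) \<bullet> h" by (simp only: inner_complex_def times_complex.sel cnj.sel)
    finally show ?thesis .
  qed
  ultimately show ?thesis by simp
qed

text \<open>The barrier is harmonic away from \<open>z\<close>, zero on the outer circle and
  constant on each concentric circle, so the weak minimum principle on the ring between radii
  \<open>s\<close> and \<open>r\<close> gives the bound. This one estimate serves both Hopf's lemma
  and the strong principle.\<close>

lemma harmonic_log_barrier: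
  fixes w :: "complex \<Rightarrow> real"
  assumes w: "has_laplacian w (\<lambda>_. 0) (ball z r)" "continuous_on (cball z r) w"
    and nonneg: "\<And>x. x \<in> cball z r \<Longrightarrow> w x \<ge> 0" and pos: "w z > 0" and r: "r > 0"
  obtains \<epsilon> s where "\<epsilon> > 0" "0 < s" "s < r"
    "\<And>x. s \<le> cmod (x - z) \<Longrightarrow> cmod (x - z) \<le> r \<Longrightarrow> \<epsilon> * ln (r / cmod (x - z)) \<le> w x"
    "\<And>x. cmod (x - z) \<le> s \<Longrightarrow> w x > 0"
proof -
  have "continuous_on (ball z r) w" using w(2) by (rule continuous_on_subset) auto
  then have "isCont w z" using r by (simp add: continuous_on_eq_continuous_at)
  then obtain d where d: "d > 0" "\<And>x. dist x z < d \<Longrightarrow> dist (w x) (w z) < w z / 2"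
    using pos unfolding continuous_at_eps_delta using half_gt_zero[OF pos] by blast
  define s where "s = min d r / 2"
  have s: "0 < s" "s < d" "s < r" using d r by (auto simp: s_def)
  have lower: "w x \<ge> w z / 2" if "cmod (x - z) = s" for x
    using d(2)[of x] that s pos unfolding dist_norm real_norm_def by linarith
  \<comment> \<open>Scaled so that the barrier equals \<open>w z / 2\<close> on the inner circle,
    where continuity gives that lower bound for \<open>w\<close>.\<close>
  define \<epsilon> where "\<epsilon> = w z / 2 / ln (r / s)"
  have lrs: "ln (r / s) > 0" using s r by (simp add: ln_gt_zero)
  have \<epsilon>: "\<epsilon> > 0" using pos lrs by (simp add: \<epsilon>_def)
  define K D where "K = cball z r - ball z s" and "D = ball z r - cball z s"
  have nz: "x \<noteq> z" if "x \<in> K" for x using that s by (auto simp: K_def)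
  have DK: "D \<subseteq> K" by (auto simp: K_def D_def)
  have D: "open D" unfolding D_def by (intro open_Diff) auto
  have cK: "compact K" unfolding K_def by (intro compact_diff) auto
  have contK: "continuous_on K (\<lambda>x. w x - \<epsilon> * (ln r - ln (cmod (x - z))))"
    by (intro continuous_intros continuous_on_subset[OF w(2)]) (use nz in \<open>auto simp: K_def\<close>)
  have lapD: "has_laplacian (\<lambda>x. w x - \<epsilon> * (ln r - ln (cmod (x - z)))) (\<lambda>_. 0) D"
  proof -
    have "has_laplacian (\<lambda>x. ln (cmod (x - z))) (\<lambda>_. 2 * 0) D"
    proof (rule has_laplacian_complex[OF D])
      show "(\<lambda>x. 1 / (x - z)) holomorphic_on D"
        using nz DK by (auto intro!: holomorphic_intros)
      show "((\<lambda>x. ln (cmod (x - z))) has_derivative (\<bullet>) (cnj (1 / (x - z)) + complex_of_real 0 * x)) (at x)"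
        if "x \<in> D" for x
      proof -
        have "((\<lambda>x. x - z) has_field_derivative 1) (at x)" by (auto intro!: derivative_eq_intros)
        then show ?thesis using has_derivative_ln_cmod[of "\<lambda>x. x - z" 1 x] nz DK that by auto
      qed
    qed
    moreover have "has_laplacian (\<lambda>x. \<epsilon> * ln r) (\<lambda>_. 0) D"
      by (rule has_laplacianI[where g="\<lambda>_. 0" and H="\<lambda>_ _. 0"]) auto
    ultimately have "has_laplacian (\<lambda>x. \<epsilon> * ln r - \<epsilon> * ln (cmod (x - z))) (\<lambda>_. 0) D"
      using has_laplacian_lincomb[of "\<lambda>x. \<epsilon> * ln r" "\<lambda>_. 0" D "\<lambda>x. ln (cmod (x - z))" "\<lambda>_. 0" 1 "-\<epsilon>"] by simp
    then show ?thesis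
      using has_laplacian_diff[OF has_laplacian_subset[OF w(1), of D], of "\<lambda>x. \<epsilon> * ln r - \<epsilon> * ln (cmod (x - z))" "\<lambda>_. 0"]
      by (simp add: D_def right_diff_distrib Diff_subset)
  qed
  have bdK: "w x - \<epsilon> * (ln r - ln (cmod (x - z))) \<ge> 0" if "x \<in> K - D" for x
  proof -
    from that consider "cmod (x - z) = r" "x \<in> cball z r" | "cmod (x - z) = s"
      unfolding K_def D_def by (cases "cmod (x - z) < r") (auto simp: dist_norm norm_minus_commute)
    then show ?thesis
    proof cases
      case 1 then show ?thesis using nonneg by simp
    next
      case 2
      have "ln r - ln (cmod (x - z)) = ln (r / s)" using 2 s r by (simp add: ln_div)
      then have "\<epsilon> * (ln r - ln (cmod (x - z))) = w z / 2"
        unfolding \<epsilon>_def using less_imp_neq[OF lrs] by (simp only:) simp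
      then show ?thesis using lower[OF 2] by simp
    qed
  qed
  have *: "w x - \<epsilon> * (ln r - ln (cmod (x - z))) \<ge> 0" if "x \<in> K" for x
    by (rule superharmonic_nonneg[OF cK contK D DK lapD _ bdK that]) auto
  show ?thesis
  proof (rule that[OF \<epsilon> s(1,3)])
    show "w x > 0" if "cmod (x - z) \<le> s" for x
      using d(2)[of x] that s pos unfolding dist_norm real_norm_def by linarith
  next
    fix x assume "s \<le> cmod (x - z)" "cmod (x - z) \<le> r"
    then show "\<epsilon> * ln (r / cmod (x - z)) \<le> w x"
      using *[of x] s r by (auto simp: K_def dist_norm norm_minus_commute ln_div)
  qed
qed

text \<open>Along the radius from \<open>q\<close> to \<open>z\<close> the barrier is
  \<open>- \<epsilon> * ln (1 - t)\<close>, which dominates \<open>\<epsilon> * t\<close>; hence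
  \<open>w\<close> has slope at least \<epsilon> at \<open>q\<close>.\<close>

lemma hopf_lemma:
  fixes w :: "complex \<Rightarrow> real"
  assumes w: "has_laplacian w (\<lambda>_. 0) (ball z r)" "continuous_on (cball z r) w"
    and nonneg: "\<And>x. x \<in> cball z r \<Longrightarrow> w x \<ge> 0" and pos: "w z > 0" and r: "r > 0"
    and q: "cmod (q - z) = r" "w q = 0" and g: "(w has_derivative (\<lambda>h. g \<bullet> h)) (at q)"
  shows "g \<bullet> (z - q) > 0"
proof (rule ccontr)
  assume neg: "\<not> ?thesis"
  obtain \<epsilon> s where e: "\<epsilon> > 0" "0 < s" "s < r"
    "\<And>x. s \<le> cmod (x - z) \<Longrightarrow> cmod (x - z) \<le> r \<Longrightarrow> \<epsilon> * ln (r / cmod (x - z)) \<le> w x"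
    by (rule harmonic_log_barrier[OF w nonneg pos r]) (assumption, rule that)
  define \<phi> where "\<phi> t = w (q + t *\<^sub>R (z - q)) - \<epsilon> * t" for t
  have "((\<lambda>t. w (q + t *\<^sub>R (z - q))) has_real_derivative (g \<bullet> (z - q))) (at 0)"
    by (rule has_derivative_along_line[OF g])
  then have "(\<phi> has_real_derivative (g \<bullet> (z - q) - \<epsilon>)) (at 0)"
    unfolding \<phi>_def by (auto intro!: derivative_eq_intros)
  then obtain d where d: "d > 0" "\<And>t. 0 < t \<Longrightarrow> t < d \<Longrightarrow> \<phi> (0 + t) < \<phi> 0"
  proof -
    have "g \<bullet> (z - q) - \<epsilon> < 0" using neg e(1) by simp
    then show ?thesis
      using DERIV_neg_dec_right[OF \<open>(\<phi> has_real_derivative _) _\<close>] that by blast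
  qed
  \<comment> \<open>The bound \<open>1 - s / r\<close> keeps the point on the radius inside the ring
    where the barrier estimate holds.\<close>
  define t where "t = min d (1 - s / r) / 2"
  have t: "0 < t" "t < d" "t \<le> 1 - s / r" "t < 1"
  proof -
    have "0 < 1 - s / r" "1 - s / r < 1" using e r by (simp_all add: field_simps)
    then show "0 < t" "t < d" "t \<le> 1 - s / r" "t < 1" using d(1) by (auto simp: t_def)
  qed
  have "q + t *\<^sub>R (z - q) - z = (1 - t) *\<^sub>R (q - z)" by (simp add: algebra_simps)
  then have n: "cmod (q + t *\<^sub>R (z - q) - z) = (1 - t) * r" using q t by simp
  have "s \<le> (1 - t) * r" using t(3) r by (simp add: field_simps)
  moreover have "(1 - t) * r \<le> r" using t r by (simp add: algebra_simps)
  ultimately have "\<epsilon> * ln (r / ((1 - t) * r)) \<le> w (q + t *\<^sub>R (z - q))"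
    using e(4)[of "q + t *\<^sub>R (z - q)"] n by simp
  moreover have "ln (r / ((1 - t) * r)) = - ln (1 - t)" using t r by (simp add: ln_div)
  moreover have "- ln (1 - t) \<ge> t" using ln_le_minus_one[of "1 - t"] t by simp
  ultimately have "\<epsilon> * t \<le> w (q + t *\<^sub>R (z - q))" using e(1)
    by (smt (verit) mult_left_mono)
  then show False using d(2)[OF t(1,2)] q by (simp add: \<phi>_def)
qed

text \<open>The zero set is open: a point with positive value close to a zero would carry a barrier
  that is still positive at that zero. Connectedness then forbids zeros and positive values to
  coexist.\<close>

lemma harmonic_pos:
  fixes w :: "complex \<Rightarrow> real"
  assumes D: "open D" "connected D" and w: "has_laplacian w (\<lambda>_. 0) D"
    and nonneg: "\<And>x. x \<in> D \<Longrightarrow> w x \<ge> 0" and y: "y \<in> D" "w y > 0" and x: "x \<in> D"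
  shows "w x > 0"
proof -
  define P Z where "P = {x \<in> D. w x > 0}" and "Z = {x \<in> D. w x = 0}"
  have cont: "continuous_on D w" by (rule has_laplacian_continuous_on[OF w])
  have "open P"
    using continuous_open_preimage[OF cont D(1), of "{0<..}"]
    unfolding P_def vimage_def Int_def by simp
  moreover have "open Z" unfolding open_contains_ball
  proof
    fix x assume "x \<in> Z"
    then have xD: "x \<in> D" and w0: "w x = 0" by (auto simp: Z_def)
    obtain e where e: "e > 0" "cball x e \<subseteq> D" using D(1) xD open_contains_cball by blast
    \<comment> \<open>With a third of \<open>e\<close>, the disc of radius \<open>2 * r\<close>
      about any \<open>y\<close> in \<open>ball x r\<close> contains \<open>x\<close> in its
      interior and stays in \<open>D\<close>.\<close>
    define r where "r = e / 3"
    have r: "r > 0" using e by (simp add: r_def)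
    have "y \<in> Z" if y: "y \<in> ball x r" for y
    proof (rule ccontr)
      assume "y \<notin> Z"
      have sub: "cball y (2 * r) \<subseteq> D"
      proof
        fix u assume "u \<in> cball y (2 * r)"
        then have "dist x u \<le> e" using y dist_triangle[of x u y] by (simp add: r_def)
        then show "u \<in> D" using e by auto
      qed
      have "y \<in> D" using sub r by (auto dest: subsetD[of _ _ y])
      then have pos: "w y > 0" using \<open>y \<notin> Z\<close> nonneg[of y] by (auto simp: Z_def)
      have ball: "has_laplacian w (\<lambda>_. 0) (ball y (2 * r))"
        using has_laplacian_subset[OF w, of "ball y (2*r)"] sub by (meson ball_subset_cball subset_trans)
      have cball: "continuous_on (cball y (2 * r)) w" using cont sub continuous_on_subset by blast
      have ge: "w u \<ge> 0" if "u \<in> cball y (2 * r)" for u using that sub nonneg by blast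
      have r2: "2 * r > 0" using r by simp
      obtain \<epsilon> s where es: "\<epsilon> > 0" "0 < s" "s < 2 * r"
        "\<And>u. s \<le> cmod (u - y) \<Longrightarrow> cmod (u - y) \<le> 2 * r \<Longrightarrow> \<epsilon> * ln (2 * r / cmod (u - y)) \<le> w u"
        "\<And>u. cmod (u - y) \<le> s \<Longrightarrow> w u > 0"
        by (rule harmonic_log_barrier[OF ball cball ge pos r2]) (assumption, rule that)
      show False
      proof (cases "cmod (x - y) \<le> s")
        case True
        then show False using es(5) w0 by fastforce
      next
        case False
        then have "cmod (x - y) > 0" "cmod (x - y) < 2 * r"
          using y r es(2) by (auto simp: dist_norm)
        then have "\<epsilon> * ln (2 * r / cmod (x - y)) > 0"
          using es(1) by (intro mult_pos_pos ln_gt_zero) (auto simp: field_simps)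
        then show False using es(4)[of x] False w0 \<open>cmod (x - y) < 2 * r\<close> by simp
      qed
    qed
    then show "\<exists>e>0. ball x e \<subseteq> Z" using r by blast
  qed
  ultimately have "P \<inter> D = {} \<or> Z \<inter> D = {}"
    using D(2) nonneg by (intro connectedD) (force simp: P_def Z_def)+
  then show ?thesis using y x nonneg[of x] by (force simp: P_def Z_def)
qed

section \<open>A torsion function that is smooth up to the boundary\<close>

text \<open>The coefficients \<open>\<kappa> n\<close> below come from Fourier coefficients: on the circle \<open>|w| = r\<close> one has
  \<open>Re (w\<^sup>n - w\<^sup>-\<^sup>n) = (1 - r\<^sup>-\<^sup>2\<^sup>n) Re (w\<^sup>n)\<close>, while
  \<open>(1 - \<beta>\<^sup>2) w / (1 + \<beta> w)\<close> has \<open>n\<close>-th Taylor coefficient \<open>(1 - \<beta>\<^sup>2) (-\<beta>)\<^sup>n\<^sup>-\<^sup>1\<close>.\<close>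

lemma real_power_series:
  fixes \<beta> r :: real
  assumes \<beta>: "0 < \<beta>" "\<beta> < 1" and r: "0 < r" "r < 1"
  obtains P where "P holomorphic_on ball 0 (1 / (\<beta> * r\<^sup>2))"
    "\<And>w. cmod w < 1 / (\<beta> * r\<^sup>2) \<Longrightarrow> P (cnj w) = cnj (P w)"
    "\<And>w. cmod w \<le> r \<Longrightarrow> P w - P (w / of_real (r\<^sup>2)) = of_real (1 - \<beta>\<^sup>2) * w / (1 + of_real \<beta> * w)"
proof -
  \<comment> \<open>The value at \<open>0\<close> is set apart because the denominator vanishes
    there; it may be zero since the prescribed right-hand side has no constant term.\<close>
  define \<kappa> where "\<kappa> n = (if n = 0 then 0 else (1 - \<beta>\<^sup>2) * (-\<beta>) ^ (n - 1) / (1 - 1 / (r\<^sup>2) ^ n))" for n :: nat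
  define P where "P w = (\<Sum>n. complex_of_real (\<kappa> n) * w ^ n)" for w
  define C where "C = (1 - \<beta>\<^sup>2) / (\<beta> * (1 - r\<^sup>2))"
  have r2: "0 < r\<^sup>2" "r\<^sup>2 < 1" using r by (auto simp: power_less_one_iff abs_square_less_1)
  have \<beta>2: "\<beta>\<^sup>2 < 1" using \<beta> by (auto simp: power_less_one_iff abs_square_less_1)
  have C: "C > 0" using \<beta> \<beta>2 r2 by (simp add: C_def)
  \<comment> \<open>For positive \<open>n\<close> the denominator is at least
    \<open>(1 - r\<^sup>2) / (r\<^sup>2) ^ n\<close> in absolute value. The resulting radius
    \<open>1 / (\<beta> * r\<^sup>2)\<close> exceeds \<open>1 / r\<close>, so the series converges
    at \<open>w\<close> and at \<open>1 / w\<close> on the whole closed concentric annulus.\<close>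
  have bound: "\<bar>\<kappa> n\<bar> \<le> C * (\<beta> * r\<^sup>2) ^ n" for n
  proof (cases n)
    case 0 then show ?thesis using C by (simp add: \<kappa>_def)
  next
    case (Suc m)
    have "(r\<^sup>2) ^ n \<le> r\<^sup>2" using r2 power_decreasing[of 1 n "r\<^sup>2"] Suc by simp
    moreover have pos: "(r\<^sup>2) ^ n > 0" using r2 by simp
    ultimately have "0 \<le> (r\<^sup>2 - (r\<^sup>2) ^ n) / (r\<^sup>2) ^ n" by simp
    also have "\<dots> = 1 / (r\<^sup>2) ^ n - 1 - (1 - r\<^sup>2) / (r\<^sup>2) ^ n"
      using r by (simp add: diff_divide_distrib)
    finally have "(1 - r\<^sup>2) / (r\<^sup>2) ^ n \<le> 1 / (r\<^sup>2) ^ n - 1" by simp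
    moreover have p1: "(1 - r\<^sup>2) / (r\<^sup>2) ^ n > 0" using pos r2 by simp
    ultimately have ge: "(1 - r\<^sup>2) / (r\<^sup>2) ^ n \<le> \<bar>1 - 1 / (r\<^sup>2) ^ n\<bar>" by linarith
    have "\<bar>\<kappa> n\<bar> = (1 - \<beta>\<^sup>2) * \<beta> ^ m / \<bar>1 - 1 / (r\<^sup>2) ^ n\<bar>"
      using Suc \<beta> \<beta>2 by (simp add: \<kappa>_def abs_mult power_abs)
    also have "\<dots> \<le> (1 - \<beta>\<^sup>2) * \<beta> ^ m / ((1 - r\<^sup>2) / (r\<^sup>2) ^ n)"
      using ge p1 \<beta> \<beta>2 by (intro divide_left_mono mult_nonneg_nonneg mult_pos_pos) auto
    also have "\<dots> = C * (\<beta> * r\<^sup>2) ^ n"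
      using \<beta> r2 Suc by (simp add: C_def power_mult_distrib field_simps)
    finally show ?thesis .
  qed
  have summ: "summable (\<lambda>n. complex_of_real (\<kappa> n) * w ^ n)" if w: "cmod w < 1 / (\<beta> * r\<^sup>2)" for w
  proof (rule summable_comparison_test)
    show "\<exists>N. \<forall>n\<ge>N. norm (complex_of_real (\<kappa> n) * w ^ n) \<le> C * (\<beta> * r\<^sup>2 * cmod w) ^ n"
    proof (intro exI allI impI)
      fix n
      have "norm (complex_of_real (\<kappa> n) * w ^ n) = \<bar>\<kappa> n\<bar> * cmod w ^ n" by (simp add: norm_mult norm_power)
      also have "\<dots> \<le> C * (\<beta> * r\<^sup>2) ^ n * cmod w ^ n" by (intro mult_right_mono bound) simp
      finally show "norm (complex_of_real (\<kappa> n) * w ^ n) \<le> C * (\<beta> * r\<^sup>2 * cmod w) ^ n"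
        by (simp only: power_mult_distrib mult.assoc)
    qed
    have "\<beta> * r\<^sup>2 * cmod w < 1" using w \<beta> r2 by (simp add: field_simps)
    then show "summable (\<lambda>n. C * (\<beta> * r\<^sup>2 * cmod w) ^ n)"
      using \<beta> by (intro summable_mult summable_geometric) simp
  qed
  show thesis
  proof (rule that)
    show "P holomorphic_on ball 0 (1 / (\<beta> * r\<^sup>2))"
    proof (rule power_series_holomorphic[where a="\<lambda>n. complex_of_real (\<kappa> n)"])
      fix w :: complex assume "w \<in> ball 0 (1 / (\<beta> * r\<^sup>2))"
      then show "(\<lambda>n. complex_of_real (\<kappa> n) * (w - 0) ^ n) sums P w"
        using summ[of w] by (simp add: P_def summable_sums)
    qed
    show "P (cnj w) = cnj (P w)" if "cmod w < 1 / (\<beta> * r\<^sup>2)" for w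
    proof -
      have "(\<lambda>n. complex_of_real (\<kappa> n) * w ^ n) sums P w"
        using summ[OF that] by (simp add: P_def summable_sums)
      then have "(\<lambda>n. cnj (complex_of_real (\<kappa> n) * w ^ n)) sums cnj (P w)"
        by (simp only: sums_cnj)
      then have "(\<lambda>n. complex_of_real (\<kappa> n) * cnj w ^ n) sums cnj (P w)"
        by (simp only: complex_cnj_mult complex_cnj_power complex_cnj_complex_of_real)
      then show ?thesis unfolding P_def[of "cnj w"] by (rule sums_unique[symmetric])
    qed
    show "P w - P (w / of_real (r\<^sup>2)) = of_real (1 - \<beta>\<^sup>2) * w / (1 + of_real \<beta> * w)" if w: "cmod w \<le> r" for w
    proof -
      have "\<beta> * r < 1" using \<beta> r mult_strict_mono[of \<beta> 1 r 1] by simp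
      then have "r < 1 / \<beta>" using \<beta> by (simp add: pos_less_divide_eq mult.commute)
      also have "1 / \<beta> = 1 / (\<beta> * r\<^sup>2) * r\<^sup>2" using r by simp
      finally have lt: "cmod w < 1 / (\<beta> * r\<^sup>2) * r\<^sup>2" using w by linarith
      also have "1 / (\<beta> * r\<^sup>2) * r\<^sup>2 < 1 / (\<beta> * r\<^sup>2) * 1"
        using r2 \<beta> by (intro mult_strict_left_mono) simp_all
      finally have 1: "cmod w < 1 / (\<beta> * r\<^sup>2)" by simp
      have 2: "cmod (w / of_real (r\<^sup>2)) < 1 / (\<beta> * r\<^sup>2)"
      proof -
        have "cmod (w / of_real (r\<^sup>2)) = cmod w / r\<^sup>2" by (simp add: norm_divide norm_power)
        also have "\<dots> < 1 / (\<beta> * r\<^sup>2)" using lt by (simp only: pos_divide_less_eq[OF r2(1)])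
        finally show ?thesis .
      qed
      let ?c = "\<lambda>n. complex_of_real (\<kappa> n) * w ^ n - complex_of_real (\<kappa> n) * (w / of_real (r\<^sup>2)) ^ n"
      have s: "?c sums (P w - P (w / of_real (r\<^sup>2)))"
        unfolding P_def by (intro sums_diff summable_sums summ 1 2)
      have c0: "?c 0 = 0" by simp
      \<comment> \<open>The difference of the two powers produces exactly the denominator of
        \<kappa>, which leaves a geometric series of ratio \<open>- (\<beta> * w)\<close>.\<close>
      have "?c (Suc n) = of_real (1 - \<beta>\<^sup>2) * w * (- (of_real \<beta> * w)) ^ n" for n
      proof -
        have "(r\<^sup>2) ^ Suc n < 1" using r2 by (intro power_Suc_less_one) auto
        then have ne: "1 - 1 / (r\<^sup>2) ^ Suc n \<noteq> 0" using r2 by (auto simp del: power_Suc simp: field_simps)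
        have "?c (Suc n) = of_real (\<kappa> (Suc n) * (1 - 1 / (r\<^sup>2) ^ Suc n)) * w ^ Suc n"
          by (simp del: power_Suc add: power_divide right_diff_distrib left_diff_distrib)
        also have "\<kappa> (Suc n) * (1 - 1 / (r\<^sup>2) ^ Suc n) = (1 - \<beta>\<^sup>2) * (-\<beta>) ^ n"
          using ne by (simp del: power_Suc add: \<kappa>_def)
        also have "of_real \<dots> * w ^ Suc n = of_real (1 - \<beta>\<^sup>2) * w * (- (of_real \<beta> * w)) ^ n"
        proof -
          have "(- (of_real \<beta> * w)) ^ n = (of_real (- \<beta>) * w) ^ n" by simp
          also have "\<dots> = of_real ((- \<beta>) ^ n) * w ^ n" by (simp only: power_mult_distrib of_real_power)
          finally show ?thesis by (simp only: of_real_mult power_Suc mult_ac)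
        qed
        finally show ?thesis .
      qed
      moreover have "(\<lambda>n. ?c (Suc n)) sums (P w - P (w / of_real (r\<^sup>2)))"
        by (subst sums_Suc_iff, subst c0, subst add_0_right, rule s)
      ultimately have "(\<lambda>n. of_real (1 - \<beta>\<^sup>2) * w * (- (of_real \<beta> * w)) ^ n) sums (P w - P (w / of_real (r\<^sup>2)))"
        by (simp only:)
      moreover have "cmod (- (of_real \<beta> * w)) < 1"
      proof -
        have "\<beta> * cmod w \<le> \<beta> * r" using w \<beta> by simp
        also have "\<dots> < 1" by fact
        finally show ?thesis using \<beta> by (simp add: norm_mult)
      qed
      then have "(\<lambda>n. of_real (1 - \<beta>\<^sup>2) * w * (- (of_real \<beta> * w)) ^ n) sums (of_real (1 - \<beta>\<^sup>2) * w * (1 / (1 - (- (of_real \<beta> * w)))))"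
        by (intro sums_mult geometric_sums)
      ultimately show ?thesis by (simp add: sums_unique2)
    qed
  qed
qed

text \<open>The points \<open>\<beta>\<close> and \<open>1 / \<beta>\<close> are inverse to each other with respect to both boundary circles, so
  \<open>z \<mapsto> (z - \<beta>) / (1 - \<beta> z)\<close> maps the annulus conformally onto the concentric one \<open>r < |w| < 1\<close>.\<close>

lemma apollonius_parameters:
  fixes a s :: real
  assumes "0 < a" "0 < s" "a + s < 1"
  obtains \<beta> r where "0 < \<beta>" "\<beta> < 1" "0 < r" "r < 1"
    "\<And>z::complex. (cmod (z - of_real \<beta>))\<^sup>2 - r\<^sup>2 * (cmod (1 - of_real \<beta> * z))\<^sup>2
       = (1 - r\<^sup>2 * \<beta>\<^sup>2) * ((cmod (z - of_real a))\<^sup>2 - s\<^sup>2)"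
proof -
  \<comment> \<open>A root expresses \<open>(b - a) * (1 / b - a) = s\<^sup>2\<close>: the points
    \<open>b\<close> and \<open>1 / b\<close> are inverse in the inner circle. The values
    \<open>h a = a * s\<^sup>2\<close> and \<open>h 1 = s\<^sup>2 - (1 - a)\<^sup>2\<close> have
    opposite signs.\<close>
  define h where "h b = a * (1 + b\<^sup>2) - b * (1 + a\<^sup>2 - s\<^sup>2)" for b
  have ha: "h a > 0" using assms by (simp add: h_def algebra_simps power2_eq_square)
  have "s\<^sup>2 < (1 - a)\<^sup>2" using assms by (intro power_strict_mono) auto
  then have h1: "h 1 < 0" by (simp add: h_def algebra_simps power2_eq_square)
  have "\<exists>b\<ge>a. b \<le> 1 \<and> h b = 0"
    using ha h1 assms by (intro IVT2') (auto simp: h_def intro!: continuous_intros)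
  then obtain \<beta> where b: "a \<le> \<beta>" "\<beta> \<le> 1" "h \<beta> = 0" by blast
  have \<beta>: "a < \<beta>" "\<beta> < 1" using b ha h1 by (auto simp: less_le)
  \<comment> \<open>This is the square of the wanted radius, obtained by comparing the coefficients
    of \<open>Re z\<close> in the claimed identity; the constant terms then match by the equation
    for \<beta>.\<close>
  define \<rho> where "\<rho> = (\<beta> - a) / (\<beta> * (1 - a * \<beta>))"
  have ab: "a * \<beta> < 1" using \<beta> assms mult_strict_mono[of a 1 \<beta> 1] by simp
  have \<rho>: "0 < \<rho>" using \<beta> ab assms by (simp add: \<rho>_def)
  have "a * \<beta>\<^sup>2 < a" using \<beta> assms by (simp add: abs_square_less_1)
  then have \<rho>1: "\<rho> < 1" using \<beta> ab assms by (simp add: \<rho>_def field_simps power2_eq_square)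
  have e1: "\<rho> * (\<beta> * (1 - a * \<beta>)) = \<beta> - a" using \<beta> ab assms by (simp add: \<rho>_def)
  have e0: "a * (1 + \<beta>\<^sup>2) = \<beta> * (1 + a\<^sup>2 - s\<^sup>2)" using b(3) by (simp add: h_def)
  have e2: "\<beta>\<^sup>2 - \<rho> = (1 - \<rho> * \<beta>\<^sup>2) * (a\<^sup>2 - s\<^sup>2)"
  proof -
    have "(1 - a * \<beta>) * \<beta> * (\<beta>\<^sup>2 - \<rho> - (1 - \<rho> * \<beta>\<^sup>2) * (a\<^sup>2 - s\<^sup>2)) = 0"
      using e0 e1 by algebra
    then show ?thesis using ab \<beta> assms by simp
  qed
  show thesis
  proof (rule that[of \<beta> "sqrt \<rho>"])
    fix z :: complex
    define x y where "x = Re z" and "y = Im z"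
    have e3: "\<beta> * (1 - \<rho>) = a * (1 - \<rho> * \<beta>\<^sup>2)"
      using e1 by (simp add: algebra_simps power2_eq_square)
    have "(cmod (z - of_real \<beta>))\<^sup>2 - \<rho> * (cmod (1 - of_real \<beta> * z))\<^sup>2
       = (x - \<beta>)\<^sup>2 + y\<^sup>2 - \<rho> * ((1 - \<beta> * x)\<^sup>2 + (\<beta> * y)\<^sup>2)"
      by (simp add: cmod_power2 x_def y_def)
    also have "\<dots> = (1 - \<rho> * \<beta>\<^sup>2) * (x\<^sup>2 + y\<^sup>2) - 2 * x * (\<beta> * (1 - \<rho>)) + (\<beta>\<^sup>2 - \<rho>)"
      by (simp add: power2_eq_square algebra_simps)
    also have "\<dots> = (1 - \<rho> * \<beta>\<^sup>2) * ((x - a)\<^sup>2 + y\<^sup>2 - s\<^sup>2)"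
      unfolding e2 e3 by (simp add: power2_eq_square algebra_simps)
    also have "(x - a)\<^sup>2 + y\<^sup>2 = (cmod (z - of_real a))\<^sup>2"
      by (simp add: cmod_power2 x_def y_def)
    finally show "(cmod (z - of_real \<beta>))\<^sup>2 - (sqrt \<rho>)\<^sup>2 * (cmod (1 - of_real \<beta> * z))\<^sup>2
       = (1 - (sqrt \<rho>)\<^sup>2 * \<beta>\<^sup>2) * ((cmod (z - of_real a))\<^sup>2 - s\<^sup>2)"
      using \<rho> by simp
  qed (use \<rho> \<rho>1 \<beta> assms in auto)
qed

text \<open>The particular solution \<open>(1 - (cmod z)\<^sup>2) / 4\<close> vanishes on the outer
  circle and is affine in \<open>Re z\<close> on the inner one. Two harmonic corrections vanish on
  the outer circle: the logarithm of \<open>cmod (\<phi> z)\<close>, constant on the inner circle,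
  and \<open>Re (F z)\<close>, which absorbs the dependence on \<open>Re z\<close>. Since the
  gradient formula holds on an open set around the closed annulus, boundary points are ordinary
  points.\<close>

lemma exists_regular_torsion_function:
  fixes a s :: real
  assumes as: "0 < a" "0 < s" "a + s < 1"
  obtains U G v where "open U" "{z. cmod z \<le> 1 \<and> s \<le> cmod (z - of_real a)} \<subseteq> U" "G holomorphic_on U"
    "\<And>z. z \<in> U \<Longrightarrow> (v has_derivative (\<lambda>h. (cnj (G z) + of_real (- 1 / 2) * z) \<bullet> h)) (at z)"
    "\<And>z. cmod z = 1 \<Longrightarrow> v z = 0" "\<And>z. cmod (z - of_real a) = s \<Longrightarrow> v z = 0"
proof -
  obtain \<beta> r where \<beta>: "0 < \<beta>" "\<beta> < 1" and r: "0 < r" "r < 1" and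
    apo: "\<And>z::complex. (cmod (z - of_real \<beta>))\<^sup>2 - r\<^sup>2 * (cmod (1 - of_real \<beta> * z))\<^sup>2
       = (1 - r\<^sup>2 * \<beta>\<^sup>2) * ((cmod (z - of_real a))\<^sup>2 - s\<^sup>2)"
    using apollonius_parameters[OF as] by metis
  obtain P where P: "P holomorphic_on ball 0 (1 / (\<beta> * r\<^sup>2))"
    "\<And>w. cmod w < 1 / (\<beta> * r\<^sup>2) \<Longrightarrow> P (cnj w) = cnj (P w)"
    "\<And>w. cmod w \<le> r \<Longrightarrow> P w - P (w / of_real (r\<^sup>2)) = of_real (1 - \<beta>\<^sup>2) * w / (1 + of_real \<beta> * w)"
    by (rule real_power_series[OF \<beta> r]) (rule that)
  have r2: "0 < r\<^sup>2" "r\<^sup>2 < 1" using r by (auto simp: power_less_one_iff abs_square_less_1)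
  have \<beta>2: "\<beta>\<^sup>2 < 1" using \<beta> by (auto simp: power_less_one_iff abs_square_less_1)
  have br: "\<beta> * r < 1" using \<beta> r mult_strict_mono[of \<beta> 1 r 1] by simp
  have m: "1 - r\<^sup>2 * \<beta>\<^sup>2 > 0" using br \<beta> r by (simp add: mult.commute abs_square_less_1 flip: power_mult_distrib)
  define R where "R = 1 / (\<beta> * r\<^sup>2)"
  have R: "R > 0" "R > 1 / r" using \<beta> r br by (auto simp: R_def field_simps power2_eq_square)
  \<comment> \<open>The points at which \<phi> and its inverse both have values in the disc of
    convergence. Written without division the set is visibly open, and the inequalities exclude
    \<beta> and \<open>1 / \<beta>\<close>.\<close>
  define U where "U = {z. \<beta> * r\<^sup>2 * cmod (1 - of_real \<beta> * z) < cmod (z - of_real \<beta>)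
      \<and> \<beta> * r\<^sup>2 * cmod (z - of_real \<beta>) < cmod (1 - of_real \<beta> * z)}"
  define \<phi> where "\<phi> z = (z - of_real \<beta>) / (1 - of_real \<beta> * z)" for z :: complex
  define F where "F z = P (\<phi> z) - P (inverse (\<phi> z))" for z
  \<comment> \<open>On the inner circle \<open>|z|\<^sup>2 = 2 a Re z - a\<^sup>2 + s\<^sup>2\<close> and \<open>Re (F z) = Re z - \<beta>\<close>; the logarithm absorbs the
    remaining constant.\<close>
  define c where "c = ((s\<^sup>2 - a\<^sup>2 - 1) / 4 + a * \<beta> / 2) / ln r"
  define v where "v z = 1 / 4 * (1 - (cmod z)\<^sup>2) + c * (ln (cmod (z - of_real \<beta>)) - ln (cmod (1 - of_real \<beta> * z)))
      + a / 2 * Re (F z)" for z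
  \<comment> \<open>The derivative of an analytic completion of the harmonic part of
    \<open>v\<close>. The logarithm has no single-valued completion around the hole, but this
    derivative is single-valued.\<close>
  define G where "G z = of_real c * (1 / (z - of_real \<beta>) + of_real \<beta> / (1 - of_real \<beta> * z)) + of_real (a / 2) * deriv F z" for z
  have U: "open U" unfolding U_def
    by (intro open_Collect_conj open_Collect_less continuous_intros)
  have nz: "z - of_real \<beta> \<noteq> 0" "1 - of_real \<beta> * z \<noteq> 0" if "z \<in> U" for z
  proof -
    have "0 \<le> \<beta> * r\<^sup>2 * cmod (1 - of_real \<beta> * z)" "0 \<le> \<beta> * r\<^sup>2 * cmod (z - of_real \<beta>)"
      using \<beta> by simp_all
    then have "0 < cmod (z - of_real \<beta>)" "0 < cmod (1 - of_real \<beta> * z)"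
      using that unfolding U_def mem_Collect_eq by linarith+
    then show "z - of_real \<beta> \<noteq> 0" "1 - of_real \<beta> * z \<noteq> 0"
      unfolding zero_less_norm_iff .
  qed
  have \<phi>R: "cmod (\<phi> z) < R" "cmod (inverse (\<phi> z)) < R" if "z \<in> U" for z
    using that nz[OF that] \<beta> r2 by (auto simp: \<phi>_def R_def U_def norm_divide norm_inverse field_simps)
  have F: "F holomorphic_on U"
  proof -
    have h: "\<phi> holomorphic_on U" unfolding \<phi>_def using nz by (intro holomorphic_intros) auto
    have i: "(\<lambda>z. inverse (\<phi> z)) holomorphic_on U"
      using nz by (intro holomorphic_intros h) (auto simp: \<phi>_def)
    have "(P \<circ> \<phi>) holomorphic_on U"
      using \<phi>R by (intro holomorphic_on_compose_gen[OF h P(1)]) (simp add: R_def image_subset_iff)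
    moreover have "(P \<circ> (\<lambda>z. inverse (\<phi> z))) holomorphic_on U"
      using \<phi>R by (intro holomorphic_on_compose_gen[OF i P(1)]) (simp add: R_def image_subset_iff)
    ultimately have "(\<lambda>z. (P \<circ> \<phi>) z - (P \<circ> (\<lambda>z. inverse (\<phi> z))) z) holomorphic_on U"
      by (rule holomorphic_on_diff)
    then show ?thesis by (simp add: F_def[abs_def] o_def)
  qed
  have outer: "(cmod (1 - of_real \<beta> * z))\<^sup>2 - (cmod (z - of_real \<beta>))\<^sup>2 = (1 - \<beta>\<^sup>2) * (1 - (cmod z)\<^sup>2)" for z
    unfolding cmod_power2 by simp algebra
  have KU: "{z. cmod z \<le> 1 \<and> s \<le> cmod (z - of_real a)} \<subseteq> U"
    proof
      fix z assume "z \<in> {z. cmod z \<le> 1 \<and> s \<le> cmod (z - of_real a)}"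
      then have z: "cmod z \<le> 1" "s \<le> cmod (z - of_real a)" by auto
      have "(cmod z)\<^sup>2 \<le> 1" using z by (simp add: abs_square_le_1)
      then have "(cmod (z - of_real \<beta>))\<^sup>2 \<le> (cmod (1 - of_real \<beta> * z))\<^sup>2"
        using outer[of z] \<beta>2 by (smt (verit) mult_nonneg_nonneg)
      then have le: "cmod (z - of_real \<beta>) \<le> cmod (1 - of_real \<beta> * z)" by (rule power2_le_imp_le) simp
      have "s\<^sup>2 \<le> (cmod (z - of_real a))\<^sup>2" using z as by (intro power_mono) auto
      then have "(r * cmod (1 - of_real \<beta> * z))\<^sup>2 \<le> (cmod (z - of_real \<beta>))\<^sup>2"
        using apo[of z] m by (smt (verit) mult_nonneg_nonneg power_mult_distrib)
      then have ge: "r * cmod (1 - of_real \<beta> * z) \<le> cmod (z - of_real \<beta>)" by (rule power2_le_imp_le) simp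
      have "\<beta> * cmod z < 1" using \<beta> z by (smt (verit) mult_left_le)
      then have pos: "cmod (1 - of_real \<beta> * z) > 0"
        using \<beta> by (auto simp: norm_mult dest: arg_cong[where f=cmod])
      have "\<beta> * r\<^sup>2 < r" using br r by (simp add: power2_eq_square)
      moreover have "\<beta> * r\<^sup>2 < 1" using calculation r by linarith
      ultimately have "\<beta> * r\<^sup>2 * cmod (1 - of_real \<beta> * z) < r * cmod (1 - of_real \<beta> * z)"
        "\<beta> * r\<^sup>2 * cmod (1 - of_real \<beta> * z) < cmod (1 - of_real \<beta> * z)" using pos by auto
      moreover have "\<beta> * r\<^sup>2 * cmod (z - of_real \<beta>) \<le> \<beta> * r\<^sup>2 * cmod (1 - of_real \<beta> * z)"
        using le \<beta> by (intro mult_left_mono) auto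
      ultimately show "z \<in> U" using ge by (auto simp: U_def)
    qed
  \<comment> \<open>Combined with the real coefficients of \<open>P\<close>, this makes the real
    parts of the two terms of \<open>F\<close> cancel for \<open>\<rho> = 1\<close>, and makes the
    functional equation of \<open>P\<close> applicable for \<open>\<rho> = r\<close>.\<close>
  have inv: "inverse (\<phi> z) = cnj (\<phi> z / of_real (\<rho>\<^sup>2))"
    if z: "z \<in> U" and \<rho>: "\<rho> > 0" and eq: "cmod (z - of_real \<beta>) = \<rho> * cmod (1 - of_real \<beta> * z)" for z \<rho>
  proof -
    define p q where "p = z - of_real \<beta>" and "q = 1 - of_real \<beta> * z"
    have ne: "p \<noteq> 0" "q \<noteq> 0" using nz[OF z] by (auto simp: p_def q_def)
    have "p * cnj p = of_real ((cmod p)\<^sup>2)" by (simp only: complex_norm_square)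
    also have "(cmod p)\<^sup>2 = \<rho>\<^sup>2 * (cmod q)\<^sup>2" using eq by (simp add: p_def q_def power_mult_distrib)
    also have "of_real \<dots> = of_real (\<rho>\<^sup>2) * (q * cnj q)" by (simp only: of_real_mult complex_norm_square)
    finally have "p * cnj p = of_real (\<rho>\<^sup>2) * (q * cnj q)" .
    then have "inverse (p / q) = cnj (p / q / of_real (\<rho>\<^sup>2))"
      using ne \<rho> by (simp add: field_simps)
    then show ?thesis by (simp add: \<phi>_def p_def q_def)
  qed
  show thesis
  proof (rule that[OF U])
    show "{z. cmod z \<le> 1 \<and> s \<le> cmod (z - of_real a)} \<subseteq> U" by (rule KU)
    show "G holomorphic_on U" unfolding G_def
      using nz by (intro holomorphic_intros holomorphic_deriv[OF F U]) auto
    show "(v has_derivative (\<lambda>h. (cnj (G z) + of_real (- 1 / 2) * z) \<bullet> h)) (at z)" if z: "z \<in> U" for z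
    proof -
      have dF: "((\<lambda>z. Re (F z)) has_derivative (\<lambda>h. Re (deriv F z * h))) (at z)"
        using holomorphic_derivI[OF F U z] unfolding has_field_derivative_def by (rule has_derivative_Re)
      have l1: "((\<lambda>z. ln (cmod (z - of_real \<beta>))) has_derivative (\<lambda>h. cnj (1 / (z - of_real \<beta>)) \<bullet> h)) (at z)"
        using nz[OF z] by (intro has_derivative_ln_cmod) (auto intro!: derivative_eq_intros)
      have l2: "((\<lambda>z. ln (cmod (1 - of_real \<beta> * z))) has_derivative (\<lambda>h. cnj (- of_real \<beta> / (1 - of_real \<beta> * z)) \<bullet> h)) (at z)"
        using nz[OF z] by (intro has_derivative_ln_cmod) (auto intro!: derivative_eq_intros)
      have n: "((\<lambda>z::complex. (cmod z)\<^sup>2) has_derivative (\<lambda>h. 2 * (z \<bullet> h))) (at z)"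
        unfolding power2_norm_eq_inner by (auto intro!: derivative_eq_intros simp: inner_commute)
      have "(v has_derivative (\<lambda>h. 1 / 4 * (0 - 2 * (z \<bullet> h)) + c * (cnj (1 / (z - of_real \<beta>)) \<bullet> h - cnj (- of_real \<beta> / (1 - of_real \<beta> * z)) \<bullet> h)
          + a / 2 * Re (deriv F z * h))) (at z)"
        unfolding v_def by (intro derivative_intros dF l1 l2 n)
      moreover have "1 / 4 * (0 - 2 * (z \<bullet> h)) + c * (cnj (1 / (z - of_real \<beta>)) \<bullet> h - cnj (- of_real \<beta> / (1 - of_real \<beta> * z)) \<bullet> h)
          + a / 2 * Re (deriv F z * h) = (cnj (G z) + of_real (- 1 / 2) * z) \<bullet> h" for h
      proof -
        have e: "cnj (G z) = c *\<^sub>R (cnj (1 / (z - of_real \<beta>)) - cnj (- of_real \<beta> / (1 - of_real \<beta> * z))) + (a / 2) *\<^sub>R cnj (deriv F z)"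
          by (simp add: G_def scaleR_conv_of_real)
        have e2: "Re (deriv F z * h) = cnj (deriv F z) \<bullet> h" by (simp add: inner_complex_def)
        have e3: "(of_real (- 1 / 2) * z) \<bullet> h = - 1 / 2 * (z \<bullet> h)"
          using inner_scaleR_left[of "- 1 / 2" z h] by (simp only: scaleR_conv_of_real)
        show ?thesis unfolding e
          using e2 e3 by (simp only: inner_add_left inner_diff_left inner_scaleR_left) simp
      qed
      ultimately show ?thesis by simp
    qed
    show "v z = 0" if z: "cmod z = 1" for z
    proof -
      have eq: "cmod (z - of_real \<beta>) = cmod (1 - of_real \<beta> * z)"
        using outer[of z] z by simp
      have "1 \<le> cmod (z - of_real a) + cmod (of_real a :: complex)"
        using norm_triangle_ineq[of "z - of_real a" "of_real a"] z by simp
      then have "z \<in> U" using KU z as by auto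
      have "inverse (\<phi> z) = cnj (\<phi> z)" using inv[OF \<open>z \<in> U\<close>, of 1] eq by simp
      then have "Re (F z) = 0" using P(2)[of "\<phi> z"] \<phi>R[OF \<open>z \<in> U\<close>] by (simp add: F_def R_def)
      then show ?thesis using z eq by (simp add: v_def)
    qed
    show "v z = 0" if z: "cmod (z - of_real a) = s" for z
    proof -
      have "(cmod (z - of_real \<beta>))\<^sup>2 = (r * cmod (1 - of_real \<beta> * z))\<^sup>2"
        using apo[of z] z by (simp add: power_mult_distrib)
      then have eq: "cmod (z - of_real \<beta>) = r * cmod (1 - of_real \<beta> * z)"
        using r by (simp add: power2_eq_iff_nonneg)
      have "cmod z \<le> 1"
        using norm_triangle_ineq[of "z - of_real a" "of_real a"] z as by simp
      then have zU: "z \<in> U" using KU z by auto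
      define w where "w = \<phi> z"
      have w: "cmod w = r" using eq nz[OF zU] by (simp add: w_def \<phi>_def norm_divide)
      have i: "inverse w = cnj (w / of_real (r\<^sup>2))" using inv[OF zU r(1) eq] by (simp add: w_def)
      have "cmod (w / of_real (r\<^sup>2)) = 1 / r"
        using w r by (simp add: norm_divide norm_mult power2_eq_square)
      then have "P (inverse w) = cnj (P (w / of_real (r\<^sup>2)))" using i P(2)[of "w / of_real (r\<^sup>2)"] R by (simp add: R_def)
      then have "Re (F z) = Re (P w - P (w / of_real (r\<^sup>2)))" by (simp add: F_def w_def)
      also have "\<dots> = Re (of_real (1 - \<beta>\<^sup>2) * w / (1 + of_real \<beta> * w))" using P(3)[of w] w by simp
      \<comment> \<open>The inverse map is \<open>z = (w + \<beta>) / (1 + \<beta> * w)\<close>, and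
        subtracting \<beta> leaves this fraction; hence the right-hand side prescribed for
        \<open>P\<close>.\<close>
      also have "of_real (1 - \<beta>\<^sup>2) * w / (1 + of_real \<beta> * w) = z - of_real \<beta>"
      proof -
        have q: "1 - of_real \<beta> * z \<noteq> 0" using nz[OF zU] by simp
        have "1 + of_real \<beta> * w = of_real (1 - \<beta>\<^sup>2) / (1 - of_real \<beta> * z)"
          using q by (simp add: w_def \<phi>_def field_simps power2_eq_square)
        moreover have "complex_of_real (1 - \<beta>\<^sup>2) \<noteq> 0" using \<beta>2 by (simp only: of_real_eq_0_iff)
        ultimately show ?thesis using q by (simp add: w_def \<phi>_def del: of_real_diff)
      qed
      finally have ReF: "Re (F z) = Re z - \<beta>" by simp
      have "ln (cmod (z - of_real \<beta>)) - ln (cmod (1 - of_real \<beta> * z)) = ln r"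
        using nz[OF zU] r unfolding eq by (simp add: ln_mult)
      moreover have "c * ln r = (s\<^sup>2 - a\<^sup>2 - 1) / 4 + a * \<beta> / 2" using r by (simp add: c_def)
      moreover have "(cmod z)\<^sup>2 = 2 * a * Re z - a\<^sup>2 + s\<^sup>2"
        using arg_cong[OF z, of "\<lambda>x. x\<^sup>2"] by (simp add: cmod_power2 power2_diff algebra_simps)
      ultimately show ?thesis by (simp add: v_def ReF field_simps)
    qed
  qed
qed

section \<open>Reflections and the normalised annulus\<close>

lemma derivative_nonneg_along_ray:
  fixes f :: "'a::real_inner \<Rightarrow> real"
  assumes f: "(f has_derivative (\<lambda>h. g \<bullet> h)) (at q)" and e: "e > 0"
    and ge: "\<And>t. 0 < t \<Longrightarrow> t < e \<Longrightarrow> f (q + t *\<^sub>R h) \<ge> f q"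
  shows "g \<bullet> h \<ge> 0"
proof (rule ccontr)
  assume "\<not> ?thesis"
  then obtain d where d: "d > 0" "\<forall>t>0. t < d \<longrightarrow> f (q + (0 + t) *\<^sub>R h) < f (q + 0 *\<^sub>R h)"
    using DERIV_neg_dec_right[OF has_derivative_along_line[OF f, of h]] by auto
  define t where "t = min d e / 2"
  have "0 < t" "t < d" "t < e" using d(1) e by (auto simp: t_def)
  then show False using d(2) ge[of t] by auto
qed

text \<open>Rotating \<open>q\<close> about \<open>c\<close> keeps \<open>v\<close> constant and
  starts with velocity \<open>\<i> * (q - c)\<close>.\<close>

lemma gradient_orthogonal_level_circle:
  fixes v :: "complex \<Rightarrow> real"
  assumes v: "(v has_derivative (\<lambda>h. g \<bullet> h)) (at q)"
    and circ: "\<And>z. cmod (z - c) = cmod (q - c) \<Longrightarrow> v z = k"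
  shows "g \<bullet> (\<i> * (q - c)) = 0"
proof -
  define \<gamma> where "\<gamma> t = c + (q - c) * exp (\<i> * complex_of_real t)" for t
  have \<gamma>: "(\<gamma> has_derivative (\<lambda>t. t *\<^sub>R (\<i> * (q - c)))) (at 0)"
    unfolding \<gamma>_def has_vector_derivative_def[symmetric]
    by (auto intro!: derivative_eq_intros has_vector_derivative_real_field)
  have \<gamma>0: "\<gamma> 0 = q" by (simp add: \<gamma>_def)
  have "((\<lambda>t. v (\<gamma> t)) has_derivative (\<lambda>t. g \<bullet> (t *\<^sub>R (\<i> * (q - c))))) (at 0)"
    using has_derivative_compose[OF \<gamma>, of v "\<lambda>h. g \<bullet> h"] v \<gamma>0 by simp
  moreover have "v (\<gamma> t) = k" for t
    by (rule circ) (simp add: \<gamma>_def norm_mult)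
  ultimately have "((\<lambda>t::real. k) has_derivative (\<lambda>t. g \<bullet> (t *\<^sub>R (\<i> * (q - c))))) (at 0)" by simp
  then have "(\<lambda>t. g \<bullet> (t *\<^sub>R (\<i> * (q - c)))) = (\<lambda>t. 0)"
    by (rule has_derivative_unique[OF _ has_derivative_const])
  from fun_cong[OF this, of 1] show ?thesis by simp
qed

text \<open>The vectors \<open>n\<close> and \<open>\<i> * n\<close> are orthonormal. On a ring this
  replaces the norm of the gradient by a normal derivative, a linear quantity that the maximum
  principle can compare.\<close>

lemma norm_eq_inner_normal:
  fixes g n :: complex
  assumes n: "cmod n = 1" and t: "g \<bullet> (\<i> * n) = 0" and p: "g \<bullet> n \<ge> 0"
  shows "cmod g = g \<bullet> n"
proof -
  have n2: "(Re n)\<^sup>2 + (Im n)\<^sup>2 = 1" using n by (metis cmod_power2 power_one)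
  have "(cmod g)\<^sup>2 = (cmod g)\<^sup>2 * ((Re n)\<^sup>2 + (Im n)\<^sup>2)" by (simp add: n2)
  also have "\<dots> = (g \<bullet> n)\<^sup>2 + (g \<bullet> (\<i> * n))\<^sup>2"
    by (simp only: cmod_power2 inner_complex_def) (simp add: power2_eq_square algebra_simps)
  finally have "(cmod g)\<^sup>2 = (g \<bullet> n)\<^sup>2" using t by simp
  then show ?thesis using p by (simp add: power2_eq_iff_nonneg)
qed

text \<open>For a unit vector \<open>e\<close> the mirror is \<open>x \<bullet> e = c\<close>; the
  caps to be reflected lie on the side \<open>x \<bullet> e \<ge> c\<close>. The case
  \<open>c = 0\<close> is the linear part.\<close>

definition line_reflection :: "'a::real_inner \<Rightarrow> real \<Rightarrow> 'a \<Rightarrow> 'a" where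
  "line_reflection e c x = x - (2 * (x \<bullet> e - c)) *\<^sub>R e"

lemma line_reflection_affine: "line_reflection e c x = (2 * c) *\<^sub>R e + line_reflection e 0 x"
  by (simp add: line_reflection_def algebra_simps)

lemma bounded_linear_line_reflection: "bounded_linear (line_reflection e 0)"
  unfolding line_reflection_def
  by (simp, intro bounded_linear_sub bounded_linear_ident bounded_linear_scaleR_const bounded_linear_const_mult bounded_linear_inner_left)

lemma inner_line_reflection: "line_reflection e 0 h \<bullet> k = h \<bullet> line_reflection e 0 k"
  by (simp add: line_reflection_def inner_diff_left inner_diff_right inner_commute)

lemma line_reflection_involutive: "norm e = 1 \<Longrightarrow> line_reflection e 0 (line_reflection e 0 h) = h"
  by (simp add: line_reflection_def inner_diff_left norm_eq_1 algebra_simps)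

text \<open>The sign of the last product decides whether a cap point moves towards or away from
  \<open>b\<close>; the reflected caps of the inner-ring and outer-ring comparisons are controlled
  through it, with \<open>b\<close> a centre of a ring.\<close>

lemma norm_line_reflection_sq:
  assumes "norm e = 1"
  shows "(norm (line_reflection e c x - b))\<^sup>2 = (norm (x - b))\<^sup>2 - 4 * (c - b \<bullet> e) * (x \<bullet> e - c)"
proof -
  have ee: "e \<bullet> e = 1" using assms by (simp add: norm_eq_1)
  show ?thesis
    unfolding power2_norm_eq_inner line_reflection_def
    by (simp add: inner_diff_left inner_diff_right inner_commute ee algebra_simps)
qed

lemma norm_line_reflection_linear: "norm e = 1 \<Longrightarrow> norm (line_reflection e 0 h) = norm h"
  using norm_line_reflection_sq[of e 0 h 0] by simp

text \<open>The vector \<open>n + 1\<close> is the difference of \<open>n\<close> and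
  \<open>-1\<close>, so the mirror through the origin perpendicular to it exchanges these unit
  vectors. The two signs record on which side of the mirror the direction to the inner centre and
  the point to be compared lie.\<close>

lemma bisector_reflection:
  fixes n :: complex
  assumes n: "cmod n = 1" "n \<noteq> -1"
  defines "e \<equiv> (n + 1) /\<^sub>R cmod (n + 1)"
  shows "cmod e = 1" "Re e > 0" "n \<bullet> e > 0" "line_reflection e 0 n = -1"
proof -
  have n0: "n + 1 \<noteq> 0" using n(2) by (metis add_eq_0_iff2)
  then have N: "cmod (n + 1) > 0" by simp
  show "cmod e = 1" using n0 by (simp add: e_def)
  have n2: "(Re n)\<^sup>2 + (Im n)\<^sup>2 = 1" using n by (metis cmod_power2 power_one)
  have "Re n \<noteq> -1" using n2 n(2) by (auto simp: complex_eq_iff)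
  moreover have "\<bar>Re n\<bar> \<le> 1" using abs_Re_le_cmod[of n] n by simp
  ultimately have re: "1 + Re n > 0" by linarith
  then show "Re e > 0" using N by (simp add: e_def add.commute)
  have ne: "n \<bullet> e = (1 + Re n) / cmod (n + 1)"
  proof -
    have "n \<bullet> (n + 1) = 1 + Re n"
      using n2 by (simp add: inner_complex_def power2_eq_square algebra_simps)
    then show ?thesis by (simp add: e_def divide_inverse mult.commute)
  qed
  then show "n \<bullet> e > 0" using re N by simp
  have N2: "(cmod (n + 1))\<^sup>2 = 2 * (1 + Re n)"
    using n2 by (simp only: cmod_power2) (simp add: power2_eq_square algebra_simps)
  have "(2 * (n \<bullet> e)) *\<^sub>R e = (2 * (1 + Re n) / (cmod (n + 1))\<^sup>2) *\<^sub>R (n + 1)"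
    unfolding ne by (simp add: e_def power2_eq_square divide_inverse)
  also have "\<dots> = n + 1" using N2 re by simp
  finally show "line_reflection e 0 n = -1" by (simp add: line_reflection_def)
qed

section \<open>The normalised annulus: sign and gradient of its torsion function\<close>

locale regular_torsion =
  fixes a s :: real and U :: "complex set" and G :: "complex \<Rightarrow> complex" and v :: "complex \<Rightarrow> real"
  assumes a: "0 < a" and s: "0 < s" and as: "a + s < 1"
    and U: "open U" "{z. cmod z \<le> 1 \<and> s \<le> cmod (z - of_real a)} \<subseteq> U"
    and G: "G holomorphic_on U"
    and v: "\<And>z. z \<in> U \<Longrightarrow> (v has_derivative (\<lambda>h. (cnj (G z) + of_real (- 1 / 2) * z) \<bullet> h)) (at z)"
    and v_outer: "\<And>z. cmod z = 1 \<Longrightarrow> v z = 0"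
    and v_inner: "\<And>z. cmod (z - of_real a) = s \<Longrightarrow> v z = 0"
begin

definition "K = {z. cmod z \<le> 1 \<and> s \<le> cmod (z - of_real a)}"
definition "\<Omega> = {z. cmod z < 1 \<and> s < cmod (z - of_real a)}"
definition "grad z = cnj (G z) + of_real (- 1 / 2) * z"

lemma KU: "K \<subseteq> U" and \<Omega>K: "\<Omega> \<subseteq> K" using U(2) by (auto simp: K_def \<Omega>_def)

lemma open_\<Omega>: "open \<Omega>"
  unfolding \<Omega>_def by (intro open_Collect_conj open_Collect_less continuous_intros)

lemma closed_K: "closed K"
  unfolding K_def by (intro closed_Collect_conj closed_Collect_le continuous_intros)

lemma compact_K: "compact K"
proof -
  have "K = cball 0 1 \<inter> K" by (auto simp: K_def)
  then show ?thesis by (metis closed_K compact_Int_closed compact_cball)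
qed

lemma dv: "z \<in> U \<Longrightarrow> (v has_derivative (\<lambda>h. grad z \<bullet> h)) (at z)"
  using v by (simp add: grad_def)

lemma lap_v: "has_laplacian v (\<lambda>_. -1) U"
  using has_laplacian_complex[OF U(1) G v] by simp

lemma cont_v: "continuous_on U v"
  by (rule has_laplacian_continuous_on[OF lap_v])

lemma v_boundary: "z \<in> K - \<Omega> \<Longrightarrow> v z = 0"
  using v_outer v_inner by (force simp: K_def \<Omega>_def)

lemma v_nonneg: "z \<in> K \<Longrightarrow> v z \<ge> 0"
  by (rule superharmonic_nonneg[OF compact_K continuous_on_subset[OF cont_v KU] open_\<Omega> \<Omega>K
        has_laplacian_subset[OF lap_v subset_trans[OF \<Omega>K KU]]]) (auto simp: v_boundary)

text \<open>A zero in the open annulus would be a minimum, where the Laplacian cannot be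
  \<open>-1\<close>.\<close>

lemma v_pos: "z \<in> \<Omega> \<Longrightarrow> v z > 0"
proof (rule ccontr)
  assume z: "z \<in> \<Omega>" and "\<not> v z > 0"
  then have "v z \<le> v y" if "y \<in> \<Omega>" for y
    using v_nonneg[of y] that \<Omega>K by force
  from has_laplacian_local_min[OF has_laplacian_subset[OF lap_v subset_trans[OF \<Omega>K KU]] open_\<Omega> z this]
  show False by simp
qed

lemma norm_grad_outer:
  assumes q: "cmod q = 1"
  shows "cmod (grad q) = grad q \<bullet> (- q)"
proof (rule norm_eq_inner_normal)
  have "1 \<le> cmod (q - of_real a) + a"
    using norm_triangle_ineq[of "q - of_real a" "of_real a"] q a by simp
  then have qK: "q \<in> K" using q as by (simp add: K_def)
  have "grad q \<bullet> (\<i> * (q - 0)) = 0"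
    by (rule gradient_orthogonal_level_circle[OF dv]) (use qK KU q v_outer in auto)
  then show "grad q \<bullet> (\<i> * - q) = 0" by simp
  show "grad q \<bullet> - q \<ge> 0"
  proof (rule derivative_nonneg_along_ray[OF dv])
    \<comment> \<open>The distance between the two rings: inward normal segments shorter than this
      stay in \<open>K\<close>.\<close>
    show "1 - a - s > 0" using as by simp
    fix t assume t: "0 < t" "t < 1 - a - s"
    have "q + t *\<^sub>R - q = (1 - t) *\<^sub>R q" by (simp add: algebra_simps)
    moreover have "(1 - t) *\<^sub>R q \<in> K"
      using t q a s norm_triangle_ineq[of "(1 - t) *\<^sub>R q - of_real a" "of_real a"] by (simp add: K_def)
    ultimately show "v q \<le> v (q + t *\<^sub>R - q)" using v_nonneg v_outer[OF q] by simp
  qed (use qK KU in auto)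
qed (use q in simp)

lemma inner_circle_in_K: "cmod (q - of_real a) = s \<Longrightarrow> cmod q \<le> a + s \<and> q \<in> K"
  using norm_triangle_ineq[of "q - of_real a" "of_real a"] a as by (simp add: K_def)

lemma norm_grad_inner:
  assumes q: "cmod (q - of_real a) = s"
  defines "n \<equiv> (q - of_real a) /\<^sub>R s"
  shows "cmod (grad q) = grad q \<bullet> n"
proof (rule norm_eq_inner_normal)
  have qK: "q \<in> K" "cmod q \<le> a + s" using inner_circle_in_K[OF q] by auto
  have "grad q \<bullet> (\<i> * (q - of_real a)) = 0"
    by (rule gradient_orthogonal_level_circle[OF dv]) (use qK KU q v_inner in auto)
  then show "grad q \<bullet> (\<i> * n) = 0" by (simp add: n_def)
  show n: "cmod n = 1" using q s by (simp add: n_def)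
  show "grad q \<bullet> n \<ge> 0"
  proof (rule derivative_nonneg_along_ray[OF dv])
    show "1 - a - s > 0" using as by simp
    fix t assume t: "0 < t" "t < 1 - a - s"
    have "q + t *\<^sub>R n - of_real a = (s + t) *\<^sub>R n" using s by (simp add: n_def algebra_simps)
    then have "cmod (q + t *\<^sub>R n - of_real a) = s + t" using n s t by simp
    moreover have "cmod (q + t *\<^sub>R n) \<le> cmod q + t" using norm_triangle_ineq[of q "t *\<^sub>R n"] n t by simp
    ultimately have "q + t *\<^sub>R n \<in> K" using t qK by (simp add: K_def)
    then show "v q \<le> v (q + t *\<^sub>R n)" using v_nonneg v_inner[OF q] by simp
  qed (use qK KU in auto)
qed

text \<open>At an interior maximum of the gradient, the derivative in the direction of the gradient is
  harmonic with an interior maximum, hence constant nearby; then the whole gradient is constant,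
  contradicting \<open>\<Delta>v = -1\<close>.\<close>

lemma grad_no_interior_max:
  assumes z0: "z0 \<in> \<Omega>"
  shows "\<exists>z\<in>\<Omega>. cmod (grad z) > cmod (grad z0)"
proof (rule ccontr)
  assume "\<not> ?thesis"
  then have max: "cmod (grad z) \<le> cmod (grad z0)" if "z \<in> \<Omega>" for z using that by force
  define M where "M = cmod (grad z0)"
  \<comment> \<open>The direction of the gradient at the supposed maximum; if that gradient
    vanishes, any unit vector serves.\<close>
  obtain e where e: "cmod e = 1" "grad z0 = M *\<^sub>R e"
  proof (cases "grad z0 = 0")
    case True then show ?thesis using that[of 1] by (simp add: M_def)
  next
    case False then show ?thesis using that[of "grad z0 /\<^sub>R M"] by (simp add: M_def)
  qed
  have ee: "e \<bullet> e = 1" using e by (simp add: norm_eq_1)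
  obtain d where d: "d > 0" "ball z0 d \<subseteq> \<Omega>" using z0 open_\<Omega> open_contains_ball by blast
  have bU: "ball z0 d \<subseteq> U" using d \<Omega>K KU by blast
  define W where "W z = M - grad z \<bullet> e" for z
  have nonneg: "W z \<ge> 0" if "z \<in> ball z0 d" for z
    using max[of z] that d norm_cauchy_schwarz[of "grad z" e] e(1) by (auto simp: W_def M_def)
  have lapW: "has_laplacian W (\<lambda>_. 2 * 0) (ball z0 d)"
  proof (rule has_laplacian_complex)
    show "(\<lambda>z. - (deriv G z * e) + cnj e / 2) holomorphic_on ball z0 d"
      by (intro holomorphic_intros holomorphic_deriv holomorphic_on_subset[OF G bU]) auto
    fix z assume z: "z \<in> ball z0 d"
    have "(G has_derivative (\<lambda>h. deriv G z * h)) (at z)"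
      using holomorphic_derivI[OF G U(1), of z] z bU unfolding has_field_derivative_def by auto
    then have "(grad has_derivative (\<lambda>h. cnj (deriv G z * h) + of_real (- 1 / 2) * h)) (at z)"
      unfolding grad_def[abs_def] by (intro derivative_intros has_derivative_cnj)
    then have "(W has_derivative (\<lambda>h. 0 - (cnj (deriv G z * h) + of_real (- 1 / 2) * h) \<bullet> e)) (at z)"
      unfolding W_def[abs_def] by (intro derivative_intros has_derivative_inner_left)
    moreover have "0 - (cnj (deriv G z * h) + of_real (- 1 / 2) * h) \<bullet> e
      = (cnj (- (deriv G z * e) + cnj e / 2) + of_real 0 * z) \<bullet> h" for h
      by (simp add: inner_complex_def algebra_simps add_divide_distrib)
    ultimately show "(W has_derivative (\<lambda>h. (cnj (- (deriv G z * e) + cnj e / 2) + of_real 0 * z) \<bullet> h)) (at z)"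
      by simp
  qed auto
  have W0: "W z0 = 0" using e ee by (simp add: W_def)
  have Wz: "W z = 0" if z: "z \<in> ball z0 d" for z
  proof (rule ccontr)
    assume "W z \<noteq> 0"
    then have "W z > 0" using nonneg[OF z] by simp
    then have "W z0 > 0"
      using harmonic_pos[of "ball z0 d" W z z0] lapW nonneg z d(1) by simp
    then show False using W0 by simp
  qed
  \<comment> \<open>Equality in the Cauchy-Schwarz inequality: a vector of norm at most
    \<open>M\<close> whose component along \<open>e\<close> is \<open>M\<close> must be
    \<open>M *\<^sub>R e\<close>.\<close>
  have const: "grad z = M *\<^sub>R e" if z: "z \<in> ball z0 d" for z
  proof -
    have "grad z \<bullet> e = M" using Wz[OF z] by (simp add: W_def)
    then have "(cmod (grad z - M *\<^sub>R e))\<^sup>2 = (cmod (grad z))\<^sup>2 - M\<^sup>2"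
      unfolding power2_norm_eq_inner
      by (simp add: inner_diff_left inner_diff_right inner_commute ee power2_eq_square)
    also have "\<dots> \<le> 0" using max[of z] z d by (auto simp: M_def intro!: power_mono)
    finally show ?thesis by simp
  qed
  have "(v has_derivative (\<lambda>h. (cnj (cnj (M *\<^sub>R e)) + of_real 0 * z) \<bullet> h)) (at z)" if "z \<in> ball z0 d" for z
    using dv[of z] const[OF that] that bU by auto
  then have "has_laplacian v (\<lambda>_. 2 * 0) (ball z0 d)"
    by (intro has_laplacian_complex[where G="\<lambda>_. cnj (M *\<^sub>R e)"]) auto
  then have "has_laplacian (\<lambda>x. v x - v x) (\<lambda>_. -1 - 0) (ball z0 d)"
    using has_laplacian_diff[OF has_laplacian_subset[OF lap_v bU]] by fastforce
  from has_laplacian_local_min[OF this open_ball, of z0] d(1) show False by simp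
qed

section \<open>Comparison by reflection in a line\<close>

context
  fixes e :: complex and c :: real
  assumes e: "cmod e = 1"
    and refl_K: "\<And>x. x \<in> K \<Longrightarrow> x \<bullet> e \<ge> c \<Longrightarrow> line_reflection e c x \<in> K"
    and refl_\<Omega>: "\<And>x. x \<in> \<Omega> \<Longrightarrow> x \<bullet> e > c \<Longrightarrow> line_reflection e c x \<in> \<Omega>"
begin

lemma lap_refl_diff:
  "has_laplacian (\<lambda>x. v (line_reflection e c x) - v x) (\<lambda>_. 0) {x \<in> U. line_reflection e c x \<in> U}"
proof -
  have "has_laplacian (\<lambda>x. v ((2 * c) *\<^sub>R e + line_reflection e 0 x)) (\<lambda>x. 1 * -1)
     {x. (2 * c) *\<^sub>R e + line_reflection e 0 x \<in> U}"
    by (rule has_laplacian_compose_conformal[OF lap_v bounded_linear_line_reflection bounded_linear_line_reflection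
        inner_line_reflection]) (simp add: line_reflection_involutive e)
  then have "has_laplacian (\<lambda>x. v (line_reflection e c x)) (\<lambda>x. 1 * -1) {x \<in> U. line_reflection e c x \<in> U}"
    unfolding line_reflection_affine[symmetric] by (rule has_laplacian_subset) auto
  from has_laplacian_diff[OF this has_laplacian_subset[OF lap_v]] show ?thesis by auto
qed

text \<open>The difference is harmonic in the cap. It vanishes on the mirror, and elsewhere on the
  boundary of the cap \<open>v\<close> is zero while the reflected point stays in \<open>K\<close>,
  where \<open>v\<close> is nonnegative.\<close>

lemma v_le_refl:
  assumes x: "x \<in> K" "x \<bullet> e \<ge> c"
  shows "v (line_reflection e c x) - v x \<ge> 0"
proof (rule superharmonic_nonneg[where K="K \<inter> {x. x \<bullet> e \<ge> c}" and D="\<Omega> \<inter> {x. x \<bullet> e > c}" and f="\<lambda>_. 0"])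
  show "compact (K \<inter> {x. x \<bullet> e \<ge> c})"
    by (intro compact_Int_closed compact_K closed_Collect_le continuous_intros)
  show "continuous_on (K \<inter> {x. x \<bullet> e \<ge> c}) (\<lambda>x. v (line_reflection e c x) - v x)"
    by (rule continuous_on_subset[OF has_laplacian_continuous_on[OF lap_refl_diff]]) (use KU refl_K in auto)
  show "open (\<Omega> \<inter> {x. x \<bullet> e > c})"
    by (intro open_Int open_\<Omega> open_Collect_less continuous_intros)
  show "has_laplacian (\<lambda>x. v (line_reflection e c x) - v x) (\<lambda>_. 0) (\<Omega> \<inter> {x. x \<bullet> e > c})"
    by (rule has_laplacian_subset[OF lap_refl_diff]) (use KU \<Omega>K refl_\<Omega> in blast)
  show "0 \<le> v (line_reflection e c x) - v x"
    if x: "x \<in> K \<inter> {x. x \<bullet> e \<ge> c} - \<Omega> \<inter> {x. x \<bullet> e > c}" for x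
  proof (cases "x \<bullet> e = c")
    case True then show ?thesis by (simp add: line_reflection_def)
  next
    case False
    then have "x \<in> K - \<Omega>" using x by auto
    then show ?thesis using v_boundary v_nonneg refl_K x by auto
  qed
qed (use x \<Omega>K in auto)

lemma has_derivative_refl_diff:
  assumes "q \<in> K" "q \<bullet> e \<ge> c"
  shows "((\<lambda>x. v (line_reflection e c x) - v x) has_derivative
     (\<lambda>h. (line_reflection e 0 (grad (line_reflection e c q)) - grad q) \<bullet> h)) (at q)"
proof -
  have "(line_reflection e c has_derivative line_reflection e 0) (at q)"
    unfolding line_reflection_affine[of e c, abs_def]
    by (auto intro!: derivative_eq_intros bounded_linear_imp_has_derivative bounded_linear_line_reflection)
  from has_derivative_compose[OF this dv] KU refl_K[OF assms]
  have "((\<lambda>x. v (line_reflection e c x)) has_derivative (\<lambda>h. grad (line_reflection e c q) \<bullet> line_reflection e 0 h)) (at q)"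
    by blast
  then have "((\<lambda>x. v (line_reflection e c x) - v x) has_derivative
      (\<lambda>h. grad (line_reflection e c q) \<bullet> line_reflection e 0 h - grad q \<bullet> h)) (at q)"
    using dv[of q] KU assms(1) by (intro has_derivative_diff) auto
  then show ?thesis by (simp add: inner_line_reflection inner_diff_left)
qed

text \<open>The gradient at \<open>q\<close> is entirely normal, whereas the reflected gradient
  enters only through its component along \<open>n\<close>, at most its norm.\<close>

lemma norm_grad_le_refl:
  assumes q: "q \<in> K" "q \<bullet> e \<ge> c" "v q = 0" "v (line_reflection e c q) = 0"
    and n: "cmod n = 1" "cmod (grad q) = grad q \<bullet> n"
    and d: "d > 0" "\<And>t. 0 < t \<Longrightarrow> t < d \<Longrightarrow> q + t *\<^sub>R n \<in> K \<and> (q + t *\<^sub>R n) \<bullet> e \<ge> c"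
  shows "cmod (grad q) \<le> cmod (grad (line_reflection e c q))"
proof -
  have "(line_reflection e 0 (grad (line_reflection e c q)) - grad q) \<bullet> n \<ge> 0"
    using d(2) v_le_refl q(3,4)
    by (intro derivative_nonneg_along_ray[OF has_derivative_refl_diff[OF q(1,2)] d(1)]) auto
  then have "cmod (grad q) \<le> line_reflection e 0 (grad (line_reflection e c q)) \<bullet> n"
    using n by (simp add: inner_diff_left)
  also have "\<dots> \<le> cmod (line_reflection e 0 (grad (line_reflection e c q)))"
    using norm_cauchy_schwarz[of "line_reflection e 0 (grad (line_reflection e c q))" n] n by simp
  finally show ?thesis using e by (simp add: norm_line_reflection_linear)
qed

text \<open>\<open>W\<close> cuts a convex, hence connected, piece out of the cap. The outer point
  \<open>y0\<close>, whose image is interior, supplies positivity of the difference; the strong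
  principle spreads it over the piece, and the ball touching at \<open>q\<close> admits Hopf's
  lemma.\<close>

lemma norm_grad_less_refl:
  assumes q: "q \<in> K" "q \<bullet> e \<ge> c" "v q = 0" "v (line_reflection e c q) = 0"
    and n: "cmod n = 1" "cmod (grad q) = grad q \<bullet> n"
    and W: "open W" "convex W" "W \<inter> ball 0 1 \<subseteq> \<Omega> \<inter> {x. x \<bullet> e > c}"
    and y0: "y0 \<in> W" "cmod y0 = 1" "line_reflection e c y0 \<in> \<Omega>"
    and r: "r > 0" "ball (q + r *\<^sub>R n) r \<subseteq> W \<inter> ball 0 1"
  shows "cmod (grad q) < cmod (grad (line_reflection e c q))"
proof -
  define w where "w x = v (line_reflection e c x) - v x" for x
  define D where "D = W \<inter> ball 0 1"
  have D: "open D" "connected D" unfolding D_def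
    using W by (auto intro!: convex_connected convex_Int)
  have D\<Omega>: "x \<in> \<Omega>" "x \<bullet> e > c" if "x \<in> D" for x using W(3) that by (auto simp: D_def)
  have nonneg: "w x \<ge> 0" if "x \<in> K" "x \<bullet> e \<ge> c" for x using v_le_refl[OF that] by (simp add: w_def)
  have lapD: "has_laplacian w (\<lambda>_. 0) D" unfolding w_def[abs_def]
    by (rule has_laplacian_subset[OF lap_refl_diff]) (use KU \<Omega>K D\<Omega> refl_\<Omega> in blast)
  define C where "C = K \<inter> {x. x \<bullet> e \<ge> c}"
  have closedC: "closed C" unfolding C_def by (intro closed_Int closed_K closed_Collect_le continuous_intros)
  have DC: "D \<subseteq> C" using D\<Omega> \<Omega>K by (auto simp: C_def less_imp_le)
  have contC: "continuous_on C w" unfolding w_def[abs_def]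
    by (rule continuous_on_subset[OF has_laplacian_continuous_on[OF lap_refl_diff]]) (use KU refl_K in \<open>auto simp: C_def\<close>)
  have y0D: "y0 \<in> closure D"
    using open_Int_closure_subset[OF W(1), of "ball 0 1"] y0(1,2) by (auto simp: D_def)
  have "w y0 > 0" using v_pos[OF y0(3)] v_outer[OF y0(2)] by (simp add: w_def)
  \<comment> \<open>The point \<open>y0\<close> lies only in the closure of \<open>D\<close>, so
    continuity is used to find positivity in \<open>D\<close> itself.\<close>
  have "\<exists>y\<in>D. w y > 0"
  proof (rule ccontr)
    assume "\<not> ?thesis"
    then have "w y \<le> 0" if "y \<in> D" for y using that by force
    then have "w y0 \<le> 0"
      using continuous_le_on_closure[OF continuous_on_subset[OF contC closure_minimal[OF DC closedC]] y0D] by blast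
    then show False using \<open>w y0 > 0\<close> by simp
  qed
  then obtain y where y: "y \<in> D" "w y > 0" by blast
  define z where "z = q + r *\<^sub>R n"
  have zD: "ball z r \<subseteq> D" using r by (simp add: z_def D_def)
  have zC: "cball z r \<subseteq> C"
    using closure_minimal[OF subset_trans[OF zD DC] closedC] r(1) by simp
  have wz: "w z > 0"
  proof (rule harmonic_pos[OF D lapD _ y])
    show "w x \<ge> 0" if "x \<in> D" for x using nonneg DC that by (auto simp: C_def)
    show "z \<in> D" using zD r(1) by (auto dest: subsetD[of _ _ z])
  qed
  have "(line_reflection e 0 (grad (line_reflection e c q)) - grad q) \<bullet> (z - q) > 0"
  proof (rule hopf_lemma[OF has_laplacian_subset[OF lapD zD] continuous_on_subset[OF contC zC] _ wz r(1)])
    show "(w has_derivative (\<lambda>h. (line_reflection e 0 (grad (line_reflection e c q)) - grad q) \<bullet> h)) (at q)"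
      unfolding w_def[abs_def] by (rule has_derivative_refl_diff[OF q(1,2)])
    show "cmod (q - z) = r" using n r by (simp add: z_def)
    show "w q = 0" using q by (simp add: w_def)
    show "0 \<le> w x" if "x \<in> cball z r" for x
      using nonneg subsetD[OF zC that] by (simp add: C_def)
  qed
  then have "(line_reflection e 0 (grad (line_reflection e c q)) - grad q) \<bullet> n > 0"
    using r(1) by (simp add: z_def zero_less_mult_iff)
  then have "cmod (grad q) < line_reflection e 0 (grad (line_reflection e c q)) \<bullet> n"
    using n by (simp add: inner_diff_left)
  also have "\<dots> \<le> cmod (line_reflection e 0 (grad (line_reflection e c q)))"
    using norm_cauchy_schwarz[of "line_reflection e 0 (grad (line_reflection e c q))" n] n by simp
  finally show ?thesis using e by (simp add: norm_line_reflection_linear)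
qed

end

text \<open>Reflection in the line through the centre of the inner ring that bisects the angle between \<open>q\<close>
  and the point of the inner ring closest to the centre of the outer ring.\<close>

lemma norm_grad_inner_less:
  assumes q: "cmod (q - of_real a) = s" "q \<noteq> of_real (a - s)"
  shows "cmod (grad q) < cmod (grad (of_real (a - s)))"
proof -
  define n where "n = (q - of_real a) /\<^sub>R s"
  have qn: "q = of_real a + s *\<^sub>R n" using s by (simp add: n_def)
  have n: "cmod n = 1" using q s by (simp add: n_def)
  have n1: "n \<noteq> -1" using q(2) by (auto simp: qn scaleR_conv_of_real)
  define e where "e = (n + 1) /\<^sub>R cmod (n + 1)"
  have e: "cmod e = 1" "Re e > 0" "n \<bullet> e > 0" "line_reflection e 0 n = -1"
    using bisector_reflection[OF n n1] by (auto simp: e_def)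
  \<comment> \<open>The mirror passes through the inner centre, so distances to it are preserved. As
    \<open>c > 0\<close>, the outer centre lies off the cap and cap points move towards it.\<close>
  define c where "c = a * Re e"
  have c: "c > 0" using a e by (simp add: c_def)
  have ae: "of_real a \<bullet> e = c" by (simp add: c_def inner_complex_def)
  have nn: "n \<bullet> n = 1" using n by (simp add: norm_eq_1)
  have qe: "q \<bullet> e - c = s * (n \<bullet> e)" unfolding qn inner_add_left ae by simp
  have norm0: "(cmod (line_reflection e c x))\<^sup>2 = (cmod x)\<^sup>2 - 4 * c * (x \<bullet> e - c)" for x
    using norm_line_reflection_sq[OF e(1), of c x 0] by simp
  have norma: "cmod (line_reflection e c x - of_real a) = cmod (x - of_real a)" for x
    using norm_line_reflection_sq[OF e(1), of c x "of_real a"] ae by (simp add: power2_eq_iff_nonneg)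
  have refl_q: "line_reflection e c q = of_real (a - s)"
  proof -
    have "line_reflection e c q = of_real a + s *\<^sub>R line_reflection e 0 n"
      using qe by (simp add: line_reflection_def qn algebra_simps)
    then show ?thesis using e(4) by (simp add: scaleR_conv_of_real)
  qed
  have refl_K: "line_reflection e c x \<in> K" if "x \<in> K" "x \<bullet> e \<ge> c" for x
  proof -
    have "(cmod (line_reflection e c x))\<^sup>2 \<le> (cmod x)\<^sup>2"
      unfolding norm0 using c that(2) by simp
    then have "cmod (line_reflection e c x) \<le> cmod x" by (rule power2_le_imp_le) simp
    then show ?thesis using that(1) by (simp add: K_def norma)
  qed
  have refl_less: "cmod (line_reflection e c x) < cmod x" if "x \<bullet> e > c" for x
  proof -
    have "(cmod (line_reflection e c x))\<^sup>2 < (cmod x)\<^sup>2"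
      unfolding norm0 using c that by simp
    then show ?thesis by (rule power2_less_imp_less) simp
  qed
  have refl_\<Omega>: "line_reflection e c x \<in> \<Omega>" if "x \<in> \<Omega>" "x \<bullet> e > c" for x
    using refl_less[OF that(2)] that(1) by (simp add: \<Omega>_def norma)
  \<comment> \<open>The second half-plane is bounded by the tangent of the inner ring at
    \<open>q\<close> and misses the inner disc, which makes the remaining piece convex.\<close>
  define W where "W = {x. x \<bullet> e > c} \<inter> {x. (x - q) \<bullet> n > 0}"
  have Wopen: "open W" unfolding W_def
    by (intro open_Int open_Collect_less continuous_intros)
  have Wconv: "convex W"
  proof -
    have "W = {x. e \<bullet> x > c} \<inter> {x. n \<bullet> x > n \<bullet> q}"
      by (auto simp: W_def inner_diff_left inner_diff_right inner_commute)
    then show ?thesis by (simp add: convex_Int convex_halfspace_gt)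
  qed
  have far: "s < cmod (x - of_real a)" if "x \<in> W" for x
  proof -
    have "s < (x - of_real a) \<bullet> n" using that nn by (simp add: W_def qn inner_diff_left inner_add_left)
    also have "\<dots> \<le> cmod (x - of_real a)" using norm_cauchy_schwarz[of "x - of_real a" n] n by simp
    finally show ?thesis .
  qed
  \<comment> \<open>The ray from the inner centre through \<open>q\<close> meets the outer ring at
    \<open>y0\<close>; by parameter 2 it has left the unit disc because
    \<open>a < 1\<close>.\<close>
  have "\<exists>t. s \<le> t \<and> t \<le> 2 \<and> cmod (of_real a + t *\<^sub>R n) = 1"
  proof (rule IVT')
    show "cmod (of_real a + s *\<^sub>R n) \<le> 1" using norm_triangle_ineq[of "of_real a" "s *\<^sub>R n"] n a s as by simp
    show "1 \<le> cmod (of_real a + 2 *\<^sub>R n)" using norm_diff_ineq[of "2 *\<^sub>R n" "of_real a"] n a s as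
      by (simp add: add.commute)
  qed (use s as a in \<open>auto intro!: continuous_intros\<close>)
  then obtain t where t: "s \<le> t" "cmod (of_real a + t *\<^sub>R n) = 1" by blast
  have "cmod (of_real a + s *\<^sub>R n) < 1" using norm_triangle_ineq[of "of_real a" "s *\<^sub>R n"] n a s as by simp
  then have ts: "s < t" using t by (cases "s = t") auto
  define y0 where "y0 = of_real a + t *\<^sub>R n"
  have y0e: "y0 \<bullet> e - c = t * (n \<bullet> e)" unfolding y0_def inner_add_left ae by simp
  then have y0c: "y0 \<bullet> e > c" using ts s e(3) by (smt (verit) mult_pos_pos)
  have "(y0 - q) \<bullet> n = t - s" using nn by (simp add: y0_def qn inner_diff_left inner_add_left)
  then have y0W: "y0 \<in> W" using y0c ts by (simp add: W_def)
  have y0\<Omega>: "line_reflection e c y0 \<in> \<Omega>"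
    using refl_less[OF y0c] t(2) far[OF y0W] by (simp add: \<Omega>_def norma y0_def)
  \<comment> \<open>The first bound keeps the ball in the unit disc, as
    \<open>cmod q \<le> a + s\<close>; the second is the distance from \<open>q\<close> to the
    mirror.\<close>
  define r where "r = min ((1 - a - s) / 2) (s * (n \<bullet> e))"
  have r: "r > 0" "2 * r \<le> 1 - a - s" "r \<le> s * (n \<bullet> e)" 
  proof -
    have "r \<le> (1 - a - s) / 2" unfolding r_def by (rule min.cobounded1)
    then show "2 * r \<le> 1 - a - s" by (simp add: field_simps)
  qed (use as s e(3) in \<open>auto simp: r_def\<close>)
  have ball: "ball (q + r *\<^sub>R n) r \<subseteq> W \<inter> ball 0 1"
  proof
    fix x assume "x \<in> ball (q + r *\<^sub>R n) r"
    then have x: "cmod (x - (q + r *\<^sub>R n)) < r" by (simp add: dist_norm norm_minus_commute)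
    define k where "k = x - (q + r *\<^sub>R n)"
    have xk: "x = q + r *\<^sub>R n + k" by (simp add: k_def)
    have k: "cmod k < r" using x by (simp add: k_def)
    have "\<bar>k \<bullet> e\<bar> < r" using Cauchy_Schwarz_ineq2[of k e] e(1) k by simp
    moreover have "x \<bullet> e - c = s * (n \<bullet> e) + r * (n \<bullet> e) + k \<bullet> e"
      using qe by (simp add: xk inner_add_left)
    moreover have "r * (n \<bullet> e) > 0" using r e by simp
    ultimately have "x \<bullet> e > c" using r by linarith
    moreover have "(x - q) \<bullet> n > 0"
      using Cauchy_Schwarz_ineq2[of k n] n k nn by (simp add: xk inner_add_left)
    moreover have "cmod x < 1"
      using norm_triangle_ineq[of "q + r *\<^sub>R n" k] norm_triangle_ineq[of q "r *\<^sub>R n"] inner_circle_in_K[OF q(1)] r n k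
      by (simp add: xk)
    ultimately show "x \<in> W \<inter> ball 0 1" by (simp add: W_def)
  qed
  have qK: "q \<in> K" using inner_circle_in_K[OF q(1)] by simp
  have "cmod (grad q) < cmod (grad (line_reflection e c q))"
  proof (rule norm_grad_less_refl[OF e(1) refl_K refl_\<Omega> qK _ _ _ n _ Wopen Wconv _ y0W _ y0\<Omega> r(1) ball])
    show "q \<bullet> e \<ge> c" using qe s e(3) by (smt (verit) mult_pos_pos)
    show "v (line_reflection e c q) = 0" using s by (simp add: refl_q v_inner)
    show "cmod (grad q) = grad q \<bullet> n" using norm_grad_inner[OF q(1)] by (simp add: n_def)
    show "W \<inter> ball 0 1 \<subseteq> \<Omega> \<inter> {x. c < x \<bullet> e}" using far by (auto simp: \<Omega>_def W_def)
  qed (use v_inner[OF q(1)] t(2) in \<open>auto simp: y0_def\<close>)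
  then show ?thesis by (simp add: refl_q)
qed

text \<open>Reflection in the line through the centre of the outer ring that bisects the angle between \<open>q\<close>
  and \<open>-1\<close>.\<close>

lemma norm_grad_outer_le:
  assumes q: "cmod q = 1"
  shows "cmod (grad q) \<le> cmod (grad (-1))"
proof (cases "q = -1")
  case False
  define e where "e = (q + 1) /\<^sub>R cmod (q + 1)"
  have e: "cmod e = 1" "Re e > 0" "q \<bullet> e > 0" "line_reflection e 0 q = -1"
    using bisector_reflection[OF q False] by (auto simp: e_def)
  have ae: "of_real a \<bullet> e = a * Re e" by (simp add: inner_complex_def)
  have norm0: "cmod (line_reflection e 0 x) = cmod x" for x
    by (rule norm_line_reflection_linear[OF e(1)])
  \<comment> \<open>The inner centre lies on the cap side of the mirror, so reflected cap points
    move away from it and cannot fall into the inner disc.\<close>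
  have norma: "cmod (x - of_real a) \<le> cmod (line_reflection e 0 x - of_real a)" if "x \<bullet> e \<ge> 0" for x
  proof -
    have "0 \<le> (a * Re e) * (x \<bullet> e)" using a e(2) that by simp
    then have "(cmod (x - of_real a))\<^sup>2 \<le> (cmod (line_reflection e 0 x - of_real a))\<^sup>2"
      unfolding norm_line_reflection_sq[OF e(1), of 0 x "of_real a"] ae by simp
    then show ?thesis by (rule power2_le_imp_le) simp
  qed
  have refl_K: "line_reflection e 0 x \<in> K" if "x \<in> K" "x \<bullet> e \<ge> 0" for x
    using norma[OF that(2)] that(1) by (simp add: K_def norm0)
  have refl_\<Omega>: "line_reflection e 0 x \<in> \<Omega>" if "x \<in> \<Omega>" "x \<bullet> e > 0" for x
    using norma[of x] that by (simp add: \<Omega>_def norm0)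
  have ray: "(1 - t) *\<^sub>R q \<in> K" if "0 \<le> t" "t < 1 - a - s" for t
    using that q a s norm_triangle_ineq[of "(1 - t) *\<^sub>R q - of_real a" "of_real a"] by (simp add: K_def)
  have "cmod (grad q) \<le> cmod (grad (line_reflection e 0 q))"
  proof (rule norm_grad_le_refl[OF e(1) refl_K refl_\<Omega>, where n="- q" and d="1 - a - s"])
    show "q \<in> K" using ray[of 0] as by simp
    show "q + t *\<^sub>R - q \<in> K \<and> 0 \<le> (q + t *\<^sub>R - q) \<bullet> e" if t: "0 < t" "t < 1 - a - s" for t
    proof -
      have eq: "q + t *\<^sub>R - q = (1 - t) *\<^sub>R q" by (simp add: algebra_simps)
      show ?thesis unfolding eq using ray[of t] t e(3) a s by simp
    qed
  qed (use e v_outer q norm_grad_outer[OF q] as in auto)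
  then show ?thesis by (simp add: e(4))
qed simp

text \<open>Reflection in the perpendicular bisector of \<open>-1\<close> and \<open>a - s\<close>. It maps the outer ring to a circle
  externally tangent to the inner ring, so the reflected cap stays inside the annulus.\<close>

lemma norm_grad_outer_less_inner: "cmod (grad (-1)) < cmod (grad (of_real (a - s)))"
proof -
  define m where "m = (a - s - 1) / 2"
  have m: "m < 0" "m > -1" "m < a - s" using a s as by (auto simp: m_def)
  let ?e = "- 1 :: complex" and ?c = "- m"
  have e: "cmod ?e = 1" by simp
  have ix: "x \<bullet> ?e = - Re x" for x by (simp add: inner_complex_def)
  have refl: "line_reflection ?e ?c x = Complex (2 * m - Re x) (Im x)" for x
    by (simp add: line_reflection_def ix complex_eq_iff)
  have norm0: "(cmod (line_reflection ?e ?c x))\<^sup>2 = (cmod x)\<^sup>2 + 4 * m * (m - Re x)" for x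
    using norm_line_reflection_sq[OF e, of ?c x 0] by (simp add: ix)
  have norm2m: "cmod (line_reflection ?e ?c x - of_real (2 * m)) = cmod x" for x
    by (simp add: refl cmod_def)
  have norma: "1 + s - cmod x \<le> cmod (line_reflection ?e ?c x - of_real a)" for x
  proof -
    have "of_real a - of_real (2 * m) = complex_of_real (a - 2 * m)" by (simp only: of_real_diff)
    also have "a - 2 * m = 1 + s" by (simp add: m_def field_simps)
    finally have "cmod (of_real a - of_real (2 * m)) = 1 + s" using s by (metis abs_of_pos add_pos_pos norm_of_real zero_less_one)
    then show ?thesis
      using norm_triangle_ineq4[of "line_reflection ?e ?c x - of_real (2 * m)" "line_reflection ?e ?c x - of_real a"] norm2m[of x]
      by simp
  qed
  have refl_less: "cmod (line_reflection ?e ?c x) < cmod x" if "Re x < m" for x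
  proof -
    have "(cmod (line_reflection ?e ?c x))\<^sup>2 < (cmod x)\<^sup>2"
      unfolding norm0 using m that by (simp add: mult_neg_pos)
    then show ?thesis by (rule power2_less_imp_less) simp
  qed
  have refl_K: "line_reflection ?e ?c x \<in> K" if "x \<in> K" "x \<bullet> ?e \<ge> ?c" for x
  proof -
    have "Re x \<le> m" using that(2) by (simp add: ix)
    then have "(cmod (line_reflection ?e ?c x))\<^sup>2 \<le> (cmod x)\<^sup>2"
      unfolding norm0 using m by (simp add: mult_nonpos_nonneg)
    then have "cmod (line_reflection ?e ?c x) \<le> cmod x" by (rule power2_le_imp_le) simp
    then show ?thesis using that(1) norma[of x] by (simp add: K_def)
  qed
  have refl_\<Omega>: "line_reflection ?e ?c x \<in> \<Omega>" if "x \<in> \<Omega>" "x \<bullet> ?e > ?c" for x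
    using refl_less[of x] that norma[of x] by (simp add: ix \<Omega>_def)
  define W where "W = {x. Re x < m}"
  have Wopen: "open W" unfolding W_def by (rule open_halfspace_Re_lt)
  have Wconv: "convex W" unfolding W_def by (rule convex_halfspace_Re_lt)
  \<comment> \<open>Any abscissa strictly between \<open>-1\<close> and \<open>m\<close> works. The
    point \<open>-1\<close> itself would not, since its image lies on the inner ring and not inside
    the annulus.\<close>
  define X where "X = (m - 1) / 2"
  have X: "-1 < X" "X < m" "X\<^sup>2 < 1" using m by (auto simp: X_def abs_square_less_1)
  define y0 where "y0 = Complex X (sqrt (1 - X\<^sup>2))"
  have y0: "cmod y0 = 1" using X by (simp add: y0_def cmod_def)
  have y0W: "y0 \<in> W" using X by (simp add: W_def y0_def)
  have y0\<Omega>: "line_reflection ?e ?c y0 \<in> \<Omega>"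
  proof -
    have "(cmod (line_reflection ?e ?c y0 - of_real a))\<^sup>2 = (2 * m - X - a)\<^sup>2 + (1 - X\<^sup>2)"
      using X by (simp add: refl cmod_power2 y0_def)
    also have "2 * m - X - a = - (1 + s + X)" by (simp add: m_def field_simps)
    also have "(- (1 + s + X))\<^sup>2 + (1 - X\<^sup>2) = s\<^sup>2 + 2 * (1 + s) * (1 + X)"
      by (simp add: power2_eq_square algebra_simps)
    also have "\<dots> > s\<^sup>2" using X s by simp
    finally have "s < cmod (line_reflection ?e ?c y0 - of_real a)" by (rule power2_less_imp_less) simp
    then show ?thesis using refl_less[of y0] y0 X by (simp add: \<Omega>_def y0_def)
  qed
  \<comment> \<open>The ball then has the segment from \<open>-1\<close> to \<open>m\<close> as a
    diameter.\<close>
  define r where "r = (m + 1) / 2"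
  have r: "r > 0" "r \<le> 1" using m by (auto simp: r_def)
  have ball: "ball (-1 + r *\<^sub>R 1) r \<subseteq> W \<inter> ball 0 1"
  proof
    fix x :: complex assume "x \<in> ball (-1 + r *\<^sub>R 1) r"
    then have x: "cmod (x - of_real (r - 1)) < r"
      by (simp add: dist_norm norm_minus_commute scaleR_conv_of_real)
    have "Re x - (r - 1) < r" using complex_Re_le_cmod[of "x - of_real (r - 1)"] x by simp
    then have "Re x < m" by (simp add: r_def field_simps)
    moreover have "cmod x \<le> cmod (x - of_real (r - 1)) + cmod (of_real (r - 1) :: complex)"
      using norm_triangle_ineq[of "x - of_real (r - 1)" "of_real (r - 1)"] by simp
    then have "cmod x < 1" using x r unfolding norm_of_real by simp
    ultimately show "x \<in> W \<inter> ball 0 1" by (simp add: W_def)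
  qed
  have p: "line_reflection ?e ?c (-1) = of_real (a - s)"
    unfolding refl by (simp add: complex_eq_iff m_def field_simps)
  have "cmod (grad (-1)) < cmod (grad (line_reflection ?e ?c (-1)))"
  proof (rule norm_grad_less_refl[OF e refl_K refl_\<Omega> _ _ _ _ _ _ Wopen Wconv _ y0W y0 y0\<Omega> r(1) ball])
    have "cmod (-1 - of_real a) = 1 + a"
      using norm_of_real[where 'a=complex, of "-1 - a"] a by simp
    then show "-1 \<in> K" using as a by (simp add: K_def)
    show "v (line_reflection ?e ?c (-1)) = 0" using s by (simp add: p v_inner)
    show "W \<inter> ball 0 1 \<subseteq> \<Omega> \<inter> {x. ?c < x \<bullet> ?e}"
    proof
      fix x assume x: "x \<in> W \<inter> ball 0 1"
      then have "s < a - Re x" using m by (simp add: W_def)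
      also have "\<dots> \<le> cmod (x - of_real a)" using abs_Re_le_cmod[of "x - of_real a"] by simp
      finally show "x \<in> \<Omega> \<inter> {x. ?c < x \<bullet> ?e}" using x unfolding ix by (simp add: W_def \<Omega>_def)
    qed
  qed (use v_outer norm_grad_outer[of "-1"] m ix in auto)
  then show ?thesis by (simp add: p)
qed

text \<open>An interior point is only known to be exceeded by another interior point, so a maximum
  over the compact set \<open>K\<close> has to be located before strictness can be concluded
  there.\<close>

lemma norm_grad_less:
  assumes z: "z \<in> K" "z \<noteq> of_real (a - s)"
  shows "cmod (grad z) < cmod (grad (of_real (a - s)))"
proof -
  have "continuous_on K (\<lambda>z. cmod (grad z))" unfolding grad_def
    by (intro continuous_intros continuous_on_subset[OF holomorphic_on_imp_continuous_on[OF G] KU])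
  then obtain z0 where z0: "z0 \<in> K" "\<And>y. y \<in> K \<Longrightarrow> cmod (grad y) \<le> cmod (grad z0)"
    using continuous_attains_sup[OF compact_K] z(1) by blast
  have "z0 \<notin> \<Omega>" using grad_no_interior_max[of z0] z0(2) \<Omega>K by force
  then have "cmod z0 = 1 \<or> cmod (z0 - of_real a) = s" using z0(1) by (auto simp: K_def \<Omega>_def)
  moreover have pK: "of_real (a - s) \<in> K" using inner_circle_in_K[of "of_real (a - s)"] s by simp
  ultimately have z0p: "z0 = of_real (a - s)"
    using norm_grad_inner_less[of z0] norm_grad_outer_le[of z0] norm_grad_outer_less_inner z0(2)[OF pK] by fastforce
  show ?thesis
  proof (cases "z \<in> \<Omega>")
    case True
    then show ?thesis using grad_no_interior_max[OF True] z0(2) \<Omega>K unfolding z0p by force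
  next
    case False
    then have "cmod z = 1 \<or> cmod (z - of_real a) = s" using z(1) by (auto simp: K_def \<Omega>_def)
    then show ?thesis
      using norm_grad_inner_less[OF _ z(2)] norm_grad_outer_le[of z] norm_grad_outer_less_inner by fastforce
  qed
qed

end

section \<open>Gradients within the closed annulus\<close>

text \<open>From \<open>x\<close> the set \<open>T\<close> contains segments towards every point of
  a ball, so both derivatives agree on those directions; differences of such directions give all
  multiples of every vector that are short enough.\<close>

lemma has_derivative_within_unique:
  fixes f :: "'a::real_normed_vector \<Rightarrow> 'b::real_normed_vector"
  assumes D1: "(f has_derivative D1) (at x within T)" and D2: "(f has_derivative D2) (at x within T)"
    and ball: "ball c r \<subseteq> T" "x \<in> cball c r" "r > 0"
  shows "D1 = D2"
proof -
  have lin: "linear D1" "linear D2" using D1 D2 has_derivative_linear by blast+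
  have eq: "D1 (y - x) = D2 (y - x)" if y: "y \<in> ball c r" for y
  proof -
    define \<gamma> where "\<gamma> t = x + t *\<^sub>R (y - x)" for t :: real
    \<comment> \<open>The point \<open>x\<close> need not belong to \<open>T\<close>, and adding it
      does not change the filter \<open>at x within T\<close>.\<close>
    have im: "\<gamma> ` {0..1} \<subseteq> insert x T"
    proof
      fix z assume "z \<in> \<gamma> ` {0..1}"
      then obtain t where t: "0 \<le> t" "t \<le> 1" "z = \<gamma> t" by auto
      show "z \<in> insert x T"
      proof (cases "t = 0")
        case True then show ?thesis using t by (simp add: \<gamma>_def)
      next
        case False
        have "\<gamma> t - c = (1 - t) *\<^sub>R (x - c) + t *\<^sub>R (y - c)" by (simp add: \<gamma>_def algebra_simps)
        then have "norm (\<gamma> t - c) \<le> (1 - t) * norm (x - c) + t * norm (y - c)"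
          using norm_triangle_ineq[of "(1 - t) *\<^sub>R (x - c)" "t *\<^sub>R (y - c)"] t by simp
        also have "\<dots> < (1 - t) * r + t * r"
        proof (rule add_le_less_mono)
          show "(1 - t) * norm (x - c) \<le> (1 - t) * r"
            using ball(2) t by (intro mult_left_mono) (auto simp: dist_norm norm_minus_commute)
          show "t * norm (y - c) < t * r"
            using y t False by (intro mult_strict_left_mono) (auto simp: dist_norm norm_minus_commute)
        qed
        finally have "\<gamma> t \<in> ball c r" by (simp add: dist_norm norm_minus_commute algebra_simps)
        then show ?thesis using ball t by auto
      qed
    qed
    have \<gamma>: "(\<gamma> has_derivative (\<lambda>t. t *\<^sub>R (y - x))) (at 0 within {0..1})"
      unfolding \<gamma>_def by (auto intro!: derivative_eq_intros)
    have der: "((\<lambda>t. f (\<gamma> t)) has_vector_derivative D (y - x)) (at 0 within {0..1})"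
      if "(f has_derivative D) (at x within T)" for D
    proof -
      have "(f has_derivative D) (at (\<gamma> 0) within \<gamma> ` {0..1})"
      proof (rule has_derivative_subset[OF _ im])
        have "at x within insert x T = at x within T" by (simp add: at_within_def)
        then show "(f has_derivative D) (at (\<gamma> 0) within insert x T)"
          using that by (simp add: \<gamma>_def)
      qed
      from has_derivative_in_compose[OF \<gamma> this]
      show ?thesis
        unfolding has_vector_derivative_def using linear_cmul[OF has_derivative_linear[OF that]] by simp
    qed
    have "at (0::real) within {0..1} \<noteq> bot" by (simp add: at_within_Icc_at_right)
    from vector_derivative_unique_within[OF this der[OF D1] der[OF D2]] show ?thesis .
  qed
  show ?thesis
  proof
    fix h :: 'a
    \<comment> \<open>Chosen so that \<open>c + \<delta> *\<^sub>R h\<close> lies in the ball also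
      for \<open>h = 0\<close>; then \<open>\<delta> *\<^sub>R h\<close> is a difference of two
      admissible directions.\<close>
    define \<delta> where "\<delta> = r / 2 / (norm h + 1)"
    have n: "norm h + 1 > 0" by (simp add: add_nonneg_pos)
    have \<delta>: "\<delta> > 0" using ball(3) n by (simp add: \<delta>_def)
    have "\<delta> * norm h \<le> \<delta> * (norm h + 1)" using \<delta> by simp
    also have "\<dots> = r / 2"
      by (rule nonzero_eq_divide_eq[THEN iffD1, OF _ \<delta>_def]) (use n in linarith)
    finally have "\<delta> * norm h < r" using ball(3) by linarith
    then have y: "c + \<delta> *\<^sub>R h \<in> ball c r" using \<delta> by (simp add: dist_norm)
    have split: "\<delta> *\<^sub>R h = (c + \<delta> *\<^sub>R h - x) - (c - x)" by simp
    have "c \<in> ball c r" using ball(3) by simp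
    then have "D1 ((c + \<delta> *\<^sub>R h - x) - (c - x)) = D2 ((c + \<delta> *\<^sub>R h - x) - (c - x))"
      by (simp only: linear_diff[OF lin(1), of "c + \<delta> *\<^sub>R h - x"]
          linear_diff[OF lin(2), of "c + \<delta> *\<^sub>R h - x"] eq[OF y] eq[of c])
    then have "D1 (\<delta> *\<^sub>R h) = D2 (\<delta> *\<^sub>R h)" by (simp only: split[symmetric])
    then show "D1 h = D2 h" using \<delta> by (simp add: linear_cmul[OF lin(1)] linear_cmul[OF lin(2)])
  qed
qed

lemma gradient_within_eqI:
  fixes u :: "'a::euclidean_space \<Rightarrow> real"
  assumes u: "(u has_derivative (\<lambda>h. inner h g)) (at x within T)"
    and ball: "ball c r \<subseteq> T" "x \<in> cball c r" "r > 0"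
  shows "gradient_within u T x = g"
  unfolding gradient_within_def
proof (rule the_equality[where P="\<lambda>g. (u has_derivative (\<lambda>h. inner h g)) (at x within T)", OF u])
  fix g' assume "(u has_derivative (\<lambda>h. inner h g')) (at x within T)"
  from fun_cong[OF has_derivative_within_unique[OF this u ball]]
  show "g' = g" by (metis inner_commute vector_eq_rdot)
qed

section \<open>Geometry of the closed annulus\<close>

lemma open_annulus: "open (annulus cO \<rho>\<^sub>1 cI \<rho>\<^sub>2)"
  unfolding annulus_def by (intro open_Collect_conj open_Collect_less continuous_intros)

text \<open>Serves both the closure and the uniqueness of boundary gradients. On the inner ring the
  centre of the ball is pushed along the outward radius; elsewhere it is moved towards the outer
  centre.\<close>

lemma annulus_interior_ball:
  assumes ann: "nonconcentric_annulus cO \<rho>\<^sub>1 cI \<rho>\<^sub>2"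
    and x: "norm (x - cO) \<le> \<rho>\<^sub>1" "\<rho>\<^sub>2 \<le> norm (x - cI)"
  obtains c r where "r > 0" "x \<in> cball c r" "ball c r \<subseteq> annulus cO \<rho>\<^sub>1 cI \<rho>\<^sub>2"
proof -
  have \<rho>: "\<rho>\<^sub>1 > 0" "\<rho>\<^sub>2 > 0" "norm (cO - cI) + \<rho>\<^sub>2 < \<rho>\<^sub>1" using ann by (auto simp: nonconcentric_annulus_def)
  show thesis
  proof (cases "norm (x - cI) = \<rho>\<^sub>2")
    case True
    have "norm (x - cO) \<le> norm (x - cI) + norm (cI - cO)" using norm_triangle_ineq[of "x - cI" "cI - cO"] by simp
    then have lt: "norm (x - cO) < \<rho>\<^sub>1" using True \<rho> by (simp add: norm_minus_commute)
    define \<tau> where "\<tau> = (\<rho>\<^sub>1 - norm (x - cO)) / 2"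
    have \<tau>: "\<tau> > 0" "norm (x - cO) + 2 * \<tau> = \<rho>\<^sub>1" using lt by (auto simp: \<tau>_def field_simps)
    define n where "n = (x - cI) /\<^sub>R \<rho>\<^sub>2"
    have n: "norm n = 1" "x - cI = \<rho>\<^sub>2 *\<^sub>R n" using True \<rho> by (auto simp: n_def)
    show thesis
    proof (rule that[OF \<tau>(1)])
      show "x \<in> cball (x + \<tau> *\<^sub>R n) \<tau>" using n \<tau> by (simp add: dist_norm)
      show "ball (x + \<tau> *\<^sub>R n) \<tau> \<subseteq> annulus cO \<rho>\<^sub>1 cI \<rho>\<^sub>2"
      proof
        fix y assume "y \<in> ball (x + \<tau> *\<^sub>R n) \<tau>"
        then have y: "norm (y - (x + \<tau> *\<^sub>R n)) < \<tau>" by (simp add: dist_norm norm_minus_commute)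
        have "y - cO = (y - (x + \<tau> *\<^sub>R n)) + ((x - cO) + \<tau> *\<^sub>R n)" by simp
        then have "norm (y - cO) \<le> norm (y - (x + \<tau> *\<^sub>R n)) + (norm (x - cO) + norm (\<tau> *\<^sub>R n))"
          by (metis norm_triangle_ineq norm_triangle_mono order_refl)
        then have "norm (y - cO) < \<rho>\<^sub>1" using y n \<tau> by simp
        moreover have "(\<rho>\<^sub>2 + \<tau>) *\<^sub>R n = (y - cI) - (y - (x + \<tau> *\<^sub>R n))"
          using n(2) by (simp add: algebra_simps)
        then have "norm ((\<rho>\<^sub>2 + \<tau>) *\<^sub>R n) \<le> norm (y - cI) + norm (y - (x + \<tau> *\<^sub>R n))"
          by (metis norm_triangle_ineq4)
        then have "\<rho>\<^sub>2 < norm (y - cI)" using y n \<tau> \<rho> by simp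
        ultimately show "y \<in> annulus cO \<rho>\<^sub>1 cI \<rho>\<^sub>2" by (simp add: annulus_def)
      qed
    qed
  next
    case False
    then have gt: "\<rho>\<^sub>2 < norm (x - cI)" using x by simp
    \<comment> \<open>The second bound keeps the diameter of the ball below the distance from
      \<open>x\<close> to the inner disc. The point \<open>cO\<close> is treated apart because the
      radius would be zero there.\<close>
    define \<tau> where "\<tau> = min (1 / 2) ((norm (x - cI) - \<rho>\<^sub>2) / (2 * \<rho>\<^sub>1))"
    have "\<tau> \<le> (norm (x - cI) - \<rho>\<^sub>2) / (2 * \<rho>\<^sub>1)" unfolding \<tau>_def by (rule min.cobounded2)
    then have \<tau>2: "2 * \<tau> * \<rho>\<^sub>1 \<le> norm (x - cI) - \<rho>\<^sub>2" using \<rho> by (simp add: field_simps)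
    have \<tau>: "\<tau> > 0" "\<tau> < 1" using gt \<rho> by (auto simp: \<tau>_def min_less_iff_disj)
    define r where "r = \<tau> * norm (x - cO)"
    have r: "2 * r \<le> norm (x - cI) - \<rho>\<^sub>2"
    proof -
      have "2 * \<tau> * norm (x - cO) \<le> 2 * \<tau> * \<rho>\<^sub>1" using x \<tau> by (intro mult_left_mono) auto
      then show ?thesis using \<tau>2 by (simp add: r_def)
    qed
    show thesis
    proof (cases "x = cO")
      case True
      have "x \<in> annulus cO \<rho>\<^sub>1 cI \<rho>\<^sub>2" using True gt \<rho> by (simp add: annulus_def)
      then obtain d where "d > 0" "ball x d \<subseteq> annulus cO \<rho>\<^sub>1 cI \<rho>\<^sub>2"
        using open_annulus open_contains_ball by blast
      then show thesis using that[of d x] by simp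
    next
      case False
      show thesis
      proof (rule that[of r "x - \<tau> *\<^sub>R (x - cO)"])
        show "r > 0" using \<tau> False by (simp add: r_def)
        show "x \<in> cball (x - \<tau> *\<^sub>R (x - cO)) r" using \<tau> by (simp add: dist_norm r_def)
        show "ball (x - \<tau> *\<^sub>R (x - cO)) r \<subseteq> annulus cO \<rho>\<^sub>1 cI \<rho>\<^sub>2"
        proof
          fix y assume "y \<in> ball (x - \<tau> *\<^sub>R (x - cO)) r"
          then have y: "norm (y - (x - \<tau> *\<^sub>R (x - cO))) < r" by (simp add: dist_norm norm_minus_commute)
          have "y - cO = (y - (x - \<tau> *\<^sub>R (x - cO))) + (1 - \<tau>) *\<^sub>R (x - cO)" by (simp add: algebra_simps)
          then have "norm (y - cO) \<le> norm (y - (x - \<tau> *\<^sub>R (x - cO))) + norm ((1 - \<tau>) *\<^sub>R (x - cO))"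
            by (metis norm_triangle_ineq)
          then have "norm (y - cO) < r + (1 - \<tau>) * norm (x - cO)" using y \<tau> by simp
          then have "norm (y - cO) < \<rho>\<^sub>1" using x(1) by (simp add: r_def algebra_simps)
          moreover have "norm (x - cI) \<le> norm (y - cI) + (norm (y - (x - \<tau> *\<^sub>R (x - cO))) + norm (\<tau> *\<^sub>R (x - cO)))"
          proof -
            define k where "k = y - (x - \<tau> *\<^sub>R (x - cO))"
            have "x - cI = (y - cI) - (k - \<tau> *\<^sub>R (x - cO))" by (simp add: k_def)
            then have "norm (x - cI) \<le> norm (y - cI) + norm (k - \<tau> *\<^sub>R (x - cO))"
              by (simp only: norm_triangle_ineq4)
            also have "\<dots> \<le> norm (y - cI) + (norm k + norm (\<tau> *\<^sub>R (x - cO)))"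
              by (intro add_left_mono norm_triangle_ineq4)
            finally show ?thesis by (simp only: k_def)
          qed
          then have "\<rho>\<^sub>2 < norm (y - cI)" using y r \<tau> by (simp add: r_def)
          ultimately show "y \<in> annulus cO \<rho>\<^sub>1 cI \<rho>\<^sub>2" by (simp add: annulus_def)
        qed
      qed
    qed
  qed
qed

lemma closure_annulus:
  assumes "nonconcentric_annulus cO \<rho>\<^sub>1 cI \<rho>\<^sub>2"
  shows "closure (annulus cO \<rho>\<^sub>1 cI \<rho>\<^sub>2) = {x. norm (x - cO) \<le> \<rho>\<^sub>1 \<and> \<rho>\<^sub>2 \<le> norm (x - cI)}"
proof
  show "closure (annulus cO \<rho>\<^sub>1 cI \<rho>\<^sub>2) \<subseteq> {x. norm (x - cO) \<le> \<rho>\<^sub>1 \<and> \<rho>\<^sub>2 \<le> norm (x - cI)}"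
    by (rule closure_minimal) (auto simp: annulus_def intro!: closed_Collect_conj closed_Collect_le continuous_intros)
  show "{x. norm (x - cO) \<le> \<rho>\<^sub>1 \<and> \<rho>\<^sub>2 \<le> norm (x - cI)} \<subseteq> closure (annulus cO \<rho>\<^sub>1 cI \<rho>\<^sub>2)"
  proof
    fix x assume "x \<in> {x. norm (x - cO) \<le> \<rho>\<^sub>1 \<and> \<rho>\<^sub>2 \<le> norm (x - cI)}"
    then obtain c r where "r > 0" "x \<in> cball c r" "ball c r \<subseteq> annulus cO \<rho>\<^sub>1 cI \<rho>\<^sub>2"
      using annulus_interior_ball[OF assms] by (metis (mono_tags, lifting) mem_Collect_eq)
    then show "x \<in> closure (annulus cO \<rho>\<^sub>1 cI \<rho>\<^sub>2)"
      using closure_mono[of "ball c r" "annulus cO \<rho>\<^sub>1 cI \<rho>\<^sub>2"] closure_ball[of r c] by blast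
  qed
qed

text \<open>The second axis is \<open>e\<close> turned by a right angle. \<open>J'\<close> is both
  adjoint and inverse of \<open>J\<close>, which lets the conformal change of variable
  apply.\<close>

lemma plane_isometry:
  fixes e :: "real^2"
  assumes "norm e = 1"
  obtains J :: "complex \<Rightarrow> real^2" and J' :: "real^2 \<Rightarrow> complex"
  where "bounded_linear J" "bounded_linear J'" "\<And>h k. J h \<bullet> k = h \<bullet> J' k"
    "\<And>k. J (J' k) = k" "\<And>h. J' (J h) = h" "J 1 = e"
proof -
  define f :: "real^2" where "f = vector [- e $ 2, e $ 1]"
  define J where "J z = Re z *\<^sub>R e + Im z *\<^sub>R f" for z
  define J' where "J' x = Complex (x \<bullet> e) (x \<bullet> f)" for x
  have "e \<bullet> e = 1" using assms by (simp add: norm_eq_1)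
  then have e: "e $ 1 * e $ 1 + e $ 2 * e $ 2 = 1" by (simp add: inner_vec_def sum_2)
  have f: "f $ 1 = - e $ 2" "f $ 2 = e $ 1" by (auto simp: f_def)
  have J'J: "J' (J h) = h" for h
    using e by (simp add: J_def J'_def complex_eq_iff inner_vec_def sum_2 f algebra_simps) (auto simp flip: distrib_left)
  have JJ': "J (J' k) = k" for k
  proof -
    have k: "k $ i * (e $ 1 * e $ 1 + e $ 2 * e $ 2) = k $ i" for i using e by simp
    show ?thesis using k[of 1] k[of 2]
      by (simp add: J_def J'_def vec_eq_iff forall_2 inner_vec_def sum_2 f algebra_simps)
  qed
  show thesis
  proof (rule that[of J J'])
    show "bounded_linear J" unfolding J_def
      by (intro bounded_linear_add bounded_linear_scaleR_const bounded_linear_Re bounded_linear_Im)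
    have "linear J'" by (rule linearI) (auto simp: J'_def complex_eq_iff inner_add_left)
    then show "bounded_linear J'" by (rule linear_conv_bounded_linear[THEN iffD1])
    show "J h \<bullet> k = h \<bullet> J' k" for h k
      by (simp add: J_def J'_def inner_complex_def inner_add_left inner_commute[of k])
  qed (simp_all add: JJ' J'J, simp add: J_def)
qed

section \<open>Transfer to the given annulus\<close>

theorem theorem1p8:
  fixes cO cI :: "real^2" and \<rho>\<^sub>1 \<rho>\<^sub>2 :: real and u :: "real^2 \<Rightarrow> real"
  assumes "nonconcentric_annulus cO \<rho>\<^sub>1 cI \<rho>\<^sub>2"
    and "torsion_function (annulus cO \<rho>\<^sub>1 cI \<rho>\<^sub>2) u"
  shows "{x. fail_point (annulus cO \<rho>\<^sub>1 cI \<rho>\<^sub>2) u x} = {closest_point (inner_ring cI \<rho>\<^sub>2) cO}"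
proof -
  define S where "S = annulus cO \<rho>\<^sub>1 cI \<rho>\<^sub>2"
  define \<delta> where "\<delta> = norm (cI - cO)"
  have \<rho>: "\<rho>\<^sub>1 > 0" "\<rho>\<^sub>2 > 0" "\<delta> > 0" "\<delta> + \<rho>\<^sub>2 < \<rho>\<^sub>1"
    using assms(1) by (auto simp: nonconcentric_annulus_def \<delta>_def norm_minus_commute)
  have openS: "open S" unfolding S_def by (rule open_annulus)
  have clS: "closure S = {x. norm (x - cO) \<le> \<rho>\<^sub>1 \<and> \<rho>\<^sub>2 \<le> norm (x - cI)}"
    unfolding S_def by (rule closure_annulus[OF assms(1)])
  have u: "C2_on u S" "continuous_on (closure S) u" "\<And>x. x \<in> S \<Longrightarrow> laplacian u x = -1"
    "\<And>x. x \<in> frontier S \<Longrightarrow> u x = 0"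
    using assms(2) unfolding torsion_function_def S_def[symmetric] by force+
  have lap_u: "has_laplacian u (\<lambda>_. -1) S"
    by (rule has_laplacian_cong[OF has_laplacian_C2_on[OF openS u(1)] u(3)])
  define a s where "a = \<delta> / \<rho>\<^sub>1" and "s = \<rho>\<^sub>2 / \<rho>\<^sub>1"
  have as3: "0 < a" "0 < s" "a + s < 1" using \<rho> by (auto simp: a_def s_def field_simps)
  obtain U G v where "open U" "{z. cmod z \<le> 1 \<and> s \<le> cmod (z - of_real a)} \<subseteq> U" "G holomorphic_on U"
    "\<And>z. z \<in> U \<Longrightarrow> (v has_derivative (\<lambda>h. (cnj (G z) + of_real (- 1 / 2) * z) \<bullet> h)) (at z)"
    "\<And>z. cmod z = 1 \<Longrightarrow> v z = 0" "\<And>z. cmod (z - of_real a) = s \<Longrightarrow> v z = 0"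
    by (rule exists_regular_torsion_function[OF as3]) (rule that)
  then interpret regular_torsion a s U G v
    using as3 by unfold_locales
  have "norm ((cI - cO) /\<^sub>R \<delta>) = 1" using \<rho>(3) by (simp add: \<delta>_def)
  then obtain J :: "complex \<Rightarrow> real^2" and J' where J: "bounded_linear J" "bounded_linear J'"
    "\<And>h k. J h \<bullet> k = h \<bullet> J' k" "\<And>k. J (J' k) = k" "\<And>h. J' (J h) = h" "J 1 = (cI - cO) /\<^sub>R \<delta>"
    by (rule plane_isometry) (rule that)
  interpret J: bounded_linear J by (rule J)
  interpret J': bounded_linear J' by (rule J)
  have normJ: "norm (J z) = cmod z" for z
    by (simp add: norm_eq_sqrt_inner J)
  define T where "T z = cO + \<rho>\<^sub>1 *\<^sub>R J z" for z
  define T' where "T' x = J' (x - cO) /\<^sub>R \<rho>\<^sub>1" for x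
  have TT': "T (T' x) = x" for x using \<rho> by (simp add: T_def T'_def J.scaleR J(4))
  have T'T: "T' (T z) = z" for z using \<rho> by (simp add: T_def T'_def J'.scaleR J(5))
  have Ta: "T (of_real a) = cI"
  proof -
    have "complex_of_real a = a *\<^sub>R 1" by (simp add: scaleR_conv_of_real)
    then show ?thesis using \<rho> by (simp add: T_def J.scaleR J(6) a_def del: complex_scaleR)
  qed
  have distT: "norm (T z - T w) = \<rho>\<^sub>1 * cmod (z - w)" for z w
    using \<rho> normJ[of "z - w"] by (simp add: T_def J.diff flip: scaleR_diff_right)
  have T0: "T 0 = cO" by (simp add: T_def J.zero)
  have nO: "norm (T z - cO) = \<rho>\<^sub>1 * cmod z" for z using distT[of z 0] T0 by simp
  have nI: "norm (T z - cI) = \<rho>\<^sub>1 * cmod (z - of_real a)" for z using distT[of z "of_real a"] Ta by simp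
  have TK: "T z \<in> closure S \<longleftrightarrow> z \<in> K" for z
  proof -
    have "\<rho>\<^sub>2 \<le> \<rho>\<^sub>1 * cmod (z - of_real a) \<longleftrightarrow> s \<le> cmod (z - of_real a)"
      using \<rho> by (simp add: s_def pos_divide_le_eq mult.commute)
    moreover have "\<rho>\<^sub>1 * cmod z \<le> \<rho>\<^sub>1 \<longleftrightarrow> cmod z \<le> 1" using \<rho> by simp
    ultimately show ?thesis by (simp add: clS nO nI K_def)
  qed
  have T\<Omega>: "T z \<in> S \<longleftrightarrow> z \<in> \<Omega>" for z
  proof -
    have "\<rho>\<^sub>2 < \<rho>\<^sub>1 * cmod (z - of_real a) \<longleftrightarrow> s < cmod (z - of_real a)"
      using \<rho> by (simp add: s_def pos_divide_less_eq mult.commute)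
    moreover have "\<rho>\<^sub>1 * cmod z < \<rho>\<^sub>1 \<longleftrightarrow> cmod z < 1" using \<rho> by simp
    ultimately show ?thesis by (simp add: S_def annulus_def nO nI \<Omega>_def)
  qed
  have contT: "continuous_on A T" for A
    unfolding T_def by (intro continuous_intros J.continuous_on)
  \<comment> \<open>Lengths are stretched by \<open>\<rho>\<^sub>1\<close>, so the pulled-back
    Laplacian acquires the factor \<open>\<rho>\<^sub>1\<^sup>2\<close>; this is why
    \<open>v\<close> is rescaled by the same factor.\<close>
  have lap_uT: "has_laplacian (\<lambda>z. u (T z)) (\<lambda>_. - (\<rho>\<^sub>1\<^sup>2)) \<Omega>"
  proof -
    have "has_laplacian (\<lambda>z. u (cO + \<rho>\<^sub>1 *\<^sub>R J z)) (\<lambda>z. \<rho>\<^sub>1\<^sup>2 * -1) {z. cO + \<rho>\<^sub>1 *\<^sub>R J z \<in> S}"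
      by (rule has_laplacian_compose_conformal[OF lap_u, where T'="\<lambda>k. \<rho>\<^sub>1 *\<^sub>R J' k"])
        (auto simp: J J.scaleR power2_eq_square intro!: bounded_linear_const_scaleR)
    then show ?thesis using T\<Omega> by (simp add: T_def)
  qed
  have lap_v2: "has_laplacian (\<lambda>z. \<rho>\<^sub>1\<^sup>2 * v z) (\<lambda>_. - (\<rho>\<^sub>1\<^sup>2)) \<Omega>"
    using has_laplacian_lincomb[OF lap_v lap_v, of "\<rho>\<^sub>1\<^sup>2" 0] KU \<Omega>K by (auto intro: has_laplacian_subset)
  have contu: "continuous_on K (\<lambda>z. u (T z))"
    by (rule continuous_on_compose2[OF u(2) contT]) (use TK in auto)
  have contv: "continuous_on K (\<lambda>z. \<rho>\<^sub>1\<^sup>2 * v z)"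
    by (intro continuous_intros continuous_on_subset[OF cont_v KU])
  have bd: "u (T z) = \<rho>\<^sub>1\<^sup>2 * v z" if "z \<in> K - \<Omega>" for z
  proof -
    have "T z \<in> frontier S" using that TK T\<Omega> openS by (simp add: frontier_def interior_open)
    then show ?thesis using u(4) v_boundary[OF that] by simp
  qed
  have uv: "u (T z) = \<rho>\<^sub>1\<^sup>2 * v z" if z: "z \<in> K" for z
  proof (rule antisym)
    have "\<rho>\<^sub>1\<^sup>2 * v z - u (T z) \<ge> 0"
      by (rule superharmonic_nonneg[OF compact_K continuous_on_diff[OF contv contu] open_\<Omega> \<Omega>K
          has_laplacian_diff[OF lap_v2 lap_uT] _ _ z]) (auto simp: bd)
    then show "u (T z) \<le> \<rho>\<^sub>1\<^sup>2 * v z" by simp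
    have "u (T z) - \<rho>\<^sub>1\<^sup>2 * v z \<ge> 0"
      by (rule superharmonic_nonneg[OF compact_K continuous_on_diff[OF contu contv] open_\<Omega> \<Omega>K
          has_laplacian_diff[OF lap_uT lap_v2] _ _ z]) (auto simp: bd)
    then show "\<rho>\<^sub>1\<^sup>2 * v z \<le> u (T z)" by simp
  qed
  \<comment> \<open>The values of \<open>u\<close> off the closure are arbitrary, so only the
    derivative within the closure is inherited from the smooth function that \<open>u\<close> agrees
    with there.\<close>
  have du: "(u has_derivative (\<lambda>h. inner h (\<rho>\<^sub>1 *\<^sub>R J (grad (T' x))))) (at x within closure S)"
    if x: "x \<in> closure S" for x
  proof -
    have K: "T' x \<in> K" using x TK[of "T' x"] TT' by simp
    have "(T' has_derivative (\<lambda>h. J' h /\<^sub>R \<rho>\<^sub>1)) (at x)"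
      unfolding T'_def by (auto intro!: derivative_eq_intros J'.has_derivative)
    from has_derivative_compose[OF this dv[of "T' x"]] K KU
    have "((\<lambda>y. v (T' y)) has_derivative (\<lambda>h. grad (T' x) \<bullet> (J' h /\<^sub>R \<rho>\<^sub>1))) (at x)" by auto
    then have "((\<lambda>y. \<rho>\<^sub>1\<^sup>2 * v (T' y)) has_derivative (\<lambda>h. \<rho>\<^sub>1\<^sup>2 * (grad (T' x) \<bullet> (J' h /\<^sub>R \<rho>\<^sub>1)))) (at x)"
      by (rule has_derivative_mult_right)
    moreover have "\<rho>\<^sub>1\<^sup>2 * (grad (T' x) \<bullet> (J' h /\<^sub>R \<rho>\<^sub>1)) = inner h (\<rho>\<^sub>1 *\<^sub>R J (grad (T' x)))" for h
      using \<rho> by (simp add: inner_commute[of h] J(3) power2_eq_square)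
    ultimately have "((\<lambda>y. \<rho>\<^sub>1\<^sup>2 * v (T' y)) has_derivative (\<lambda>h. inner h (\<rho>\<^sub>1 *\<^sub>R J (grad (T' x))))) (at x within closure S)"
      by (simp add: has_derivative_at_withinI)
    then show ?thesis
    proof (rule has_derivative_transform[OF x, rotated])
      fix y assume "y \<in> closure S"
      then have "T' y \<in> K" using TK[of "T' y"] TT' by simp
      then show "u y = \<rho>\<^sub>1\<^sup>2 * v (T' y)" using uv[of "T' y"] TT' by simp
    qed
  qed
  have grad_u: "norm (gradient_within u (closure S) x) = \<rho>\<^sub>1 * cmod (grad (T' x))" if x: "x \<in> closure S" for x
  proof -
    have "norm (x - cO) \<le> \<rho>\<^sub>1" "\<rho>\<^sub>2 \<le> norm (x - cI)" using x clS by auto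
    then obtain c r where "r > 0" "x \<in> cball c r" "ball c r \<subseteq> annulus cO \<rho>\<^sub>1 cI \<rho>\<^sub>2"
      by (rule annulus_interior_ball[OF assms(1)]) (rule that)
    then have "gradient_within u (closure S) x = \<rho>\<^sub>1 *\<^sub>R J (grad (T' x))"
      using gradient_within_eqI[OF du[OF x], of c r] closure_subset[of S] by (simp add: S_def[symmetric])
    then show ?thesis using \<rho> by (simp add: normJ)
  qed
  have diff: "u differentiable_on closure S"
    unfolding differentiable_on_def differentiable_def using du by blast
  define p where "p = T (of_real (a - s))"
  have pK: "p \<in> closure S"
    unfolding p_def TK using inner_circle_in_K[of "of_real (a - s)"] as3 by (simp flip: of_real_diff)
  have less: "norm (gradient_within u (closure S) x) < norm (gradient_within u (closure S) p)"
    if x: "x \<in> closure S" "x \<noteq> p" for x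
  proof -
    have "T' x \<in> K" using x TK[of "T' x"] TT' by simp
    moreover have "T' x \<noteq> of_real (a - s)" using x(2) TT' by (metis p_def)
    ultimately show ?thesis
      using norm_grad_less[of "T' x"] \<rho>(1) by (simp add: grad_u x(1) pK) (simp add: p_def T'T)
  qed
  have fail: "fail_point S u x \<longleftrightarrow> x = p" for x
    unfolding fail_point_def using diff pK less by (metis less_eq_real_def linorder_not_less)
  have "closest_point (inner_ring cI \<rho>\<^sub>2) cO = p"
  proof -
    have closed: "closed (inner_ring cI \<rho>\<^sub>2)" unfolding inner_ring_def
      by (intro closed_Collect_eq continuous_intros)
    have pR: "p \<in> inner_ring cI \<rho>\<^sub>2" 
    proof -
      have "cmod (of_real (a - s) - of_real a) = s" using as3 by simp
      then show ?thesis using \<rho> by (simp only: inner_ring_def p_def nI mem_Collect_eq) (simp add: s_def)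
    qed
    \<comment> \<open>\<open>closest_point\<close> is a choice among minimisers and the ring is not
      convex, so uniqueness of the minimiser is derived by coordinates.\<close>
    define q where "q = closest_point (inner_ring cI \<rho>\<^sub>2) cO"
    have q: "q \<in> inner_ring cI \<rho>\<^sub>2" "dist cO q \<le> dist cO p"
      unfolding q_def using closest_point_in_set[OF closed] closest_point_le[OF closed pR] pR by blast+
    define z where "z = T' q"
    have Tz: "T z = q" by (simp add: z_def TT')
    have z1: "cmod (z - of_real a) = s"
      using q(1) \<rho> nI[of z] by (simp add: inner_ring_def Tz s_def field_simps)
    have "\<rho>\<^sub>1 * cmod z \<le> \<rho>\<^sub>1 * cmod (of_real (a - s))"
      using q(2) unfolding dist_norm norm_minus_commute[of cO] Tz[symmetric] p_def nO .
    then have "cmod z \<le> \<bar>a - s\<bar>" using \<rho> by (simp only: norm_of_real mult_le_cancel_left_pos)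
    then have z2: "(cmod z)\<^sup>2 \<le> (a - s)\<^sup>2" by (simp add: abs_le_square_iff[symmetric])
    \<comment> \<open>On the inner ring the squared distance to the outer centre is increasing in
      \<open>Re z\<close> because \<open>a > 0\<close>; minimality therefore forces the leftmost
      point.\<close>
    have "(cmod z)\<^sup>2 = s\<^sup>2 - a\<^sup>2 + 2 * a * Re z"
      using arg_cong[OF z1, of "\<lambda>x. x\<^sup>2"] by (simp add: cmod_power2 power2_diff algebra_simps)
    then have "a * Re z \<le> a * (a - s)" using z2 by (simp add: power2_diff algebra_simps power2_eq_square)
    then have "Re z \<le> a - s" using as3 by simp
    moreover have "\<bar>Re z - a\<bar> \<le> s" using abs_Re_le_cmod[of "z - of_real a"] z1 by simp
    ultimately have re: "Re z = a - s" by linarith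
    have "(cmod (z - of_real a))\<^sup>2 = s\<^sup>2 + (Im z)\<^sup>2" using re by (simp add: cmod_power2)
    then have "Im z = 0" using z1 by simp
    then have "z = of_real (a - s)" using re by (simp add: complex_eq_iff)
    then show ?thesis using Tz by (simp add: q_def p_def)
  qed
  then show ?thesis using fail by (auto simp: S_def)
qed

end
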